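(* Let $G$ be a compact connected Lie group with Lie algebra $\mathfrak g$, let $\langle\cdot,\cdot\rangle$ be an $\mathrm{Ad}_G$-invariant scalar product on $\mathfrak g$ (used to identify $\mathfrak g^*\cong\mathfrak g$), let $\mathbb I:\mathfrak g\to\mathfrak g$ be a symmetric positive definite operator, let $k\ge 1$, and let $\epsilon\neq 0$ be a real parameter. On the open subset of $\mathfrak g^{k+1}(m,e_1,\dots,e_k)$ where $e_1,\dots,e_k$ are linearly independent, consider the system $$\dot m=[m,\omega]+\sum_{i=1}^k\lambda^i e_i,\qquad m=\mathbb I\omega,\qquad \dot e_i=\epsilon[e_i,\omega],\quad i=1,\dots,k,$$ where $\lambda^i=-\sum_{j=1}^k\langle e_j,\mathbb I^{-1}[m,\omega]\rangle\,\mathbb A^{ij}$, with $(\mathbb A^{ij})$ the inverse of the matrix $\mathbb A_{ij}=\langle e_i,\mathbb I^{-1}e_j\rangle$, $i,j=1,\dots,k$. Then this system has the invariant measure $$\mu_\epsilon\,\mathrm dm\wedge\mathrm de_1\wedge\cdots\wedge\mathrm de_k,\qquad\text{equivalently}\qquad \mu_\epsilon\,\mathrm d\omega\wedge\mathrm de_1\wedge\cdots\wedge\mathrm de_k,$$ with density $\mu_\epsilon=\Delta^{\frac{1}{2\epsilon}}$, where $\Delta=\det(\langle\mathbb I^{-1}e_i,e_j\rangle)_{i,j=1}^k$.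
   Context: $\mathrm dm,\mathrm d\omega,\mathrm de_i$ denote the standard (Lebesgue) volume forms on $\mathfrak g$ with respect to the metric $\langle\cdot,\cdot\rangle$. The multipliers $\lambda^i$ are exactly those for which the functions $\langle\omega,e_i\rangle$ are conserved along trajectories. This system is called the $\epsilon$LR system. *)

theory Defs
  imports "HOL-Analysis.Analysis"
begin

text \<open>A finite-dimensional real Lie algebra (the Lie algebra g of a compact connected
Lie group), modelled on a Euclidean space whose inner product is the invariant scalar
product; br is the Lie bracket.\<close>
definition lie_algebra_invariant :: "('g::euclidean_space \<Rightarrow> 'g \<Rightarrow> 'g) \<Rightarrow> bool" where
  "lie_algebra_invariant br \<longleftrightarrow>
     bilinear br \<and>
     (\<forall>x y. br x y = - br y x) \<and>
     (\<forall>x y z. br x (br y z) + br y (br z x) + br z (br x y) = 0) \<and>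
     (\<forall>x y z. inner (br x y) z = inner x (br y z))"

definition sym_pos_def_op :: "('g::euclidean_space \<Rightarrow> 'g) \<Rightarrow> bool" where
  "sym_pos_def_op I \<longleftrightarrow> linear I \<and> (\<forall>x y. inner (I x) y = inner x (I y)) \<and>
     (\<forall>x. x \<noteq> 0 \<longrightarrow> inner (I x) x > 0)"

definition lin_indep_family :: "'g::euclidean_space ^ 'k \<Rightarrow> bool" where
  "lin_indep_family e \<longleftrightarrow> (\<forall>c::'k \<Rightarrow> real. (\<Sum>i\<in>UNIV. c i *\<^sub>R e $ i) = 0 \<longrightarrow> (\<forall>i. c i = 0))"

definition phase_set :: "('g::euclidean_space \<times> ('g ^ 'k)) set" where
  "phase_set = {(x, e). lin_indep_family e}"

definition Amat :: "('g::euclidean_space \<Rightarrow> 'g) \<Rightarrow> 'g ^ 'k \<Rightarrow> real ^ 'k ^ 'k" where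
  "Amat I e = (\<chi> i j. inner (e $ i) (inv I (e $ j)))"

definition multipliers ::
  "('g::euclidean_space \<Rightarrow> 'g \<Rightarrow> 'g) \<Rightarrow> ('g \<Rightarrow> 'g) \<Rightarrow> 'g \<Rightarrow> 'g ^ 'k \<Rightarrow> 'k \<Rightarrow> real" where
  "multipliers br I m e i =
     (let \<omega> = inv I m in
      - (\<Sum>j\<in>UNIV. inner (e $ j) (inv I (br m \<omega>)) * (matrix_inv (Amat I e)) $ i $ j))"

definition eLR_field_m ::
  "('g::euclidean_space \<Rightarrow> 'g \<Rightarrow> 'g) \<Rightarrow> ('g \<Rightarrow> 'g) \<Rightarrow> real \<Rightarrow> 'g \<times> ('g ^ 'k) \<Rightarrow> 'g \<times> ('g ^ 'k)" where
  "eLR_field_m br I \<epsilon> = (\<lambda>(m, e). let \<omega> = inv I m in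
     (br m \<omega> + (\<Sum>i\<in>UNIV. multipliers br I m e i *\<^sub>R e $ i),
      \<chi> i. \<epsilon> *\<^sub>R br (e $ i) \<omega>))"

definition eLR_field_omega ::
  "('g::euclidean_space \<Rightarrow> 'g \<Rightarrow> 'g) \<Rightarrow> ('g \<Rightarrow> 'g) \<Rightarrow> real \<Rightarrow> 'g \<times> ('g ^ 'k) \<Rightarrow> 'g \<times> ('g ^ 'k)" where
  "eLR_field_omega br I \<epsilon> = (\<lambda>(\<omega>, e). let m = I \<omega> in
     (inv I (br m \<omega> + (\<Sum>i\<in>UNIV. multipliers br I m e i *\<^sub>R e $ i)),
      \<chi> i. \<epsilon> *\<^sub>R br (e $ i) \<omega>))"

definition invariant_measure ::
  "('a::euclidean_space) set \<Rightarrow> ('a \<Rightarrow> 'a) \<Rightarrow> ('a \<Rightarrow> real) \<Rightarrow> bool" where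
  "invariant_measure U X \<mu> \<longleftrightarrow>
     (\<forall>(\<phi>::real \<Rightarrow> 'a \<Rightarrow> 'a) t A.
        A \<in> sets lborel \<and> A \<subseteq> U \<and>
        (\<forall>x\<in>A. \<phi> 0 x = x \<and>
           (\<forall>s\<in>closed_segment 0 t. \<phi> s x \<in> U \<and>
              ((\<lambda>r. \<phi> r x) has_vector_derivative X (\<phi> s x)) (at s within closed_segment 0 t)))
        \<longrightarrow> (\<integral>\<^sup>+x\<in>\<phi> t ` A. ennreal (\<mu> x) \<partial>lborel) = (\<integral>\<^sup>+x\<in>A. ennreal (\<mu> x) \<partial>lborel))"

end

(* The field X is C1 on the open set U where the Gram determinant Delta does not vanish, and
   div (mu X) = 0: the divergence of X is minus the sum S of A^{ij} <J e_j, [e_i, omega]> (with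
   J = I^{-1}), while Delta' = 2 epsilon S Delta along X by Jacobi's formula.

   It remains to prove Liouville's theorem for an arbitrary family of trajectories starting in A.
   Comparing the trajectories with solutions of the variational equation (Gronwall) shows that
   the time-t map is injective and differentiable *within A*, so neither the existence of a flow
   nor an extension of the map to a neighbourhood of A is needed. Since mu times the determinant
   of the solution of the variational equation is constant in time, the change of variables
   formula on A gives the claim. *)
theory Submission
  imports Defs
begin

text \<open>The divergence is a trace, so only the diagonal blocks of the derivative count: the
  derivative of the inverse Gram matrix never has to be computed. In the \<open>m\<close>-block, the
  two derivatives of \<open>br m (J m)\<close> are traceless by invariance of the scalar product and
  symmetry of \<open>J\<close>; the multiplier part is a sum of rank-one maps, and half of its trace
  cancels because a symmetric matrix meets an antisymmetric expression. The \<open>e\<close>-block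
  is traceless because bracketing with a fixed element is skew.

  The shape of the Liouville part is dictated by \<open>invariant_measure\<close>: the family of
  curves carries no regularity in the starting point, the Borel set \<open>A\<close> may have empty
  interior, and the integrals may be infinite. Hence each estimate compares two individual
  trajectories, and the change of variables formula is needed for nonnegative integrals with
  infinity allowed.

  The equation for \<open>\<omega>\<close> is the one for \<open>m\<close> conjugated by a constant
  linear map, which changes neither the trace nor the density.\<close>

section \<open>Trajectories of C1 vector fields\<close>

text \<open>The square of the norm is used since it is differentiable at 0.\<close>

lemma gronwall_norm_square:
  fixes z :: "real \<Rightarrow> 'a::real_inner"
  assumes z: "\<And>s. s \<in> {0..T} \<Longrightarrow> (z has_vector_derivative z' s) (at s within {0..T})"
    and z': "\<And>s. s \<in> {0..T} \<Longrightarrow> norm (z' s) \<le> L * norm (z s) + c"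
    and "0 \<le> L" "0 \<le> c" "0 \<le> T"
  shows "(norm (z T))\<^sup>2 \<le> exp ((2 * L + 1) * T) * ((norm (z 0))\<^sup>2 + c\<^sup>2 * T)"
proof -
  \<comment> \<open>The \<open>2 * L\<close> cancels the linear part of the bound on
    \<open>z'\<close>, and the extra 1 pays for
    \<open>2 * c * norm (z s) \<le> c\<^sup>2 + (norm (z s))\<^sup>2\<close>. With
    \<open>c\<^sup>2 * s\<close> subtracted, the slope of \<open>f\<close> is nonpositive.\<close>
  define K where "K = 2 * L + 1"
  define f where "f s = exp (- K * s) * (z s \<bullet> z s) - c\<^sup>2 * s" for s
  define f' where "f' s = exp (- K * s) * (2 * (z s \<bullet> z' s) - K * (z s \<bullet> z s)) - c\<^sup>2" for s
  have f: "(f has_derivative (\<lambda>h. f' s * h)) (at s within {0..T})" if "0 \<le> s" "s \<le> T" for s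
    unfolding f_def f'_def
    using z[of s] that unfolding has_vector_derivative_def
    by (auto intro!: derivative_eq_intros simp: algebra_simps inner_commute)
  obtain s where s: "s \<in> {0..T}" "f T - f 0 = f' s * (T - 0)"
    using mvt_very_simple[OF \<open>0 \<le> T\<close> f] by blast
  have "z s \<bullet> z' s \<le> norm (z s) * norm (z' s)"
    by (rule norm_cauchy_schwarz)
  also have "\<dots> \<le> norm (z s) * (L * norm (z s) + c)"
    using z'[OF s(1)] by (simp add: mult_left_mono)
  finally have "2 * (z s \<bullet> z' s) - K * (z s \<bullet> z s) \<le> 2 * c * norm (z s) - (norm (z s))\<^sup>2"
    by (simp add: K_def dot_square_norm algebra_simps power2_eq_square)
  also have "\<dots> \<le> c\<^sup>2"
    using sum_squares_bound[of c "norm (z s)"] by simp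
  finally have le: "2 * (z s \<bullet> z' s) - K * (z s \<bullet> z s) \<le> c\<^sup>2" .
  have "0 \<le> K * s"
    using s \<open>0 \<le> L\<close> by (simp add: K_def)
  then have "exp (- K * s) * (2 * (z s \<bullet> z' s) - K * (z s \<bullet> z s)) \<le> exp (- K * s) * c\<^sup>2"
    using le by (intro mult_left_mono) auto
  also have "\<dots> \<le> 1 * c\<^sup>2"
    using \<open>0 \<le> K * s\<close> by (intro mult_right_mono) auto
  finally have "f' s \<le> 0"
    by (simp add: f'_def)
  then have "f' s * T \<le> 0"
    using \<open>0 \<le> T\<close> by (rule mult_nonpos_nonneg)
  then have "f T \<le> f 0"
    using s by simp
  then have "exp (- K * T) * (norm (z T))\<^sup>2 \<le> (norm (z 0))\<^sup>2 + c\<^sup>2 * T"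
    by (simp add: f_def dot_square_norm)
  then have "exp (K * T) * (exp (- K * T) * (norm (z T))\<^sup>2) \<le> exp (K * T) * ((norm (z 0))\<^sup>2 + c\<^sup>2 * T)"
    by (intro mult_left_mono) auto
  moreover have "exp (K * T) * exp (- K * T) = 1"
    by (simp flip: exp_add)
  ultimately show ?thesis
    unfolding K_def[symmetric] by (simp only: mult.assoc[symmetric] mult_1_left)
qed

text \<open>The derivative takes values in the normed space of bounded linear maps, so its
  continuity is in the operator norm and becomes uniform on compact sets; differentiability of the
  time map rests on this uniformity.\<close>

definition C1_on :: "'a::real_normed_vector set \<Rightarrow> ('a \<Rightarrow> 'b::real_normed_vector) \<Rightarrow> ('a \<Rightarrow> 'a \<Rightarrow>\<^sub>L 'b) \<Rightarrow> bool"
  where "C1_on U f f' \<longleftrightarrow>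
    (\<forall>x\<in>U. (f has_derivative blinfun_apply (f' x)) (at x)) \<and> continuous_on U f'"

lemma C1_onD:
  assumes "C1_on U f f'"
  shows "x \<in> U \<Longrightarrow> (f has_derivative blinfun_apply (f' x)) (at x)" "continuous_on U f'"
  using assms by (auto simp: C1_on_def)

lemma C1_on_scaleR: "C1_on U f f' \<Longrightarrow> C1_on U (\<lambda>x. c *\<^sub>R f x) (\<lambda>x. c *\<^sub>R f' x)"
  unfolding C1_on_def
  by (auto intro!: continuous_intros derivative_eq_intros simp: scaleR_blinfun.rep_eq)

text \<open>Time is normalised to \<open>{0..1}\<close>: an end time \<open>t\<close> of either sign
  is reached with the field \<open>t *\<^sub>R X\<close>.\<close>

definition solution_on :: "'a set \<Rightarrow> ('a::real_normed_vector \<Rightarrow> 'a) \<Rightarrow> (real \<Rightarrow> 'a) \<Rightarrow> bool"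
  where "solution_on U Y u \<longleftrightarrow>
    (\<forall>s\<in>{0..1}. u s \<in> U \<and> (u has_vector_derivative Y (u s)) (at s within {0..1}))"

lemma solution_onD:
  assumes "solution_on U Y u" "s \<in> {0..1}"
  shows "u s \<in> U" "(u has_vector_derivative Y (u s)) (at s within {0..1})"
  using assms by (auto simp: solution_on_def)

lemma solution_on_continuous: "solution_on U Y u \<Longrightarrow> continuous_on {0..1} u"
  by (auto simp: solution_on_def intro!: continuous_on_vector_derivative)

text \<open>Turns a forward estimate into a backward one, which is how injectivity of the time-one
  map is obtained.\<close>

lemma solution_on_reverse:
  assumes "solution_on U Y u"
  shows "solution_on U (\<lambda>x. - 1 *\<^sub>R Y x) (\<lambda>s. u (1 - s))"
  unfolding solution_on_def
proof (intro ballI conjI)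
  fix s :: real assume s: "s \<in> {0..1}"
  then have s': "1 - s \<in> {0..1}" by auto
  show "u (1 - s) \<in> U" using solution_onD[OF assms s'] by simp
  have "(u has_vector_derivative Y (u (1 - s))) (at (1 - s) within (\<lambda>s. 1 - s) ` {0..1})"
    using solution_onD(2)[OF assms s'] by (rule has_vector_derivative_within_subset) auto
  moreover have "((\<lambda>s. 1 - s) has_vector_derivative - 1) (at s within {0..1::real})"
    by (auto intro!: derivative_eq_intros)
  ultimately have "(u \<circ> (\<lambda>s. 1 - s) has_vector_derivative - 1 *\<^sub>R Y (u (1 - s))) (at s within {0..1})"
    by (intro vector_diff_chain_within)
  then show "((\<lambda>s. u (1 - s)) has_vector_derivative - 1 *\<^sub>R Y (u (1 - s))) (at s within {0..1})"
    by (simp add: o_def)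
qed

text \<open>Compactness of the trajectory in the open set \<open>U\<close> leaves room for a closed
  tube of fixed radius. The tube supplies the Lipschitz constant for Gronwall and, for the
  linearisation, a modulus of continuity of \<open>Y'\<close> uniform in time.\<close>

lemma trajectory_tube:
  fixes u :: "real \<Rightarrow> 'a::euclidean_space" and Y' :: "'a \<Rightarrow> 'a \<Rightarrow>\<^sub>L 'a"
  assumes "open U" "continuous_on {0..1} u" "u ` {0..1} \<subseteq> U" "continuous_on U Y'"
  obtains r L where "0 < r" "0 \<le> L"
    "\<And>s p. s \<in> {0..1} \<Longrightarrow> p \<in> cball (u s) r \<Longrightarrow> p \<in> U \<and> norm (Y' p) \<le> L"
    "\<And>\<eta>. \<eta> > 0 \<Longrightarrow> \<exists>d>0. d \<le> r \<and> (\<forall>s\<in>{0..1}. \<forall>p\<in>cball (u s) d. norm (Y' p - Y' (u s)) \<le> \<eta>)"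
proof -
  have cu: "compact (u ` {0..1})"
    using assms by (intro compact_continuous_image) auto
  obtain r where r: "0 < r" "(\<Union>x\<in>u ` {0..1}. cball x r) \<subseteq> U"
    using compact_subset_open_imp_cball_epsilon_subset[OF cu \<open>open U\<close> assms(3)] by blast
  \<comment> \<open>\<open>K\<close> is the union of the balls \<open>cball (u s) r\<close>; written
    as the image of a product of compact sets under addition, it is visibly compact.\<close>
  define K where "K = (\<lambda>(x, h). x + h) ` (u ` {0..1} \<times> cball 0 r)"
  have K: "p \<in> K" if "s \<in> {0..1}" "p \<in> cball (u s) r" for s p
    unfolding K_def using that
    by (intro image_eqI[where x = "(u s, p - u s)"]) (auto simp: dist_norm norm_minus_commute)
  have KU: "K \<subseteq> U"
    using r(2) by (force simp: K_def dist_norm)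
  have "compact K"
    unfolding K_def case_prod_unfold
    by (intro compact_continuous_image[OF _ compact_Times[OF cu compact_cball]] continuous_intros)
  have cY: "continuous_on K Y'"
    using assms(4) KU by (rule continuous_on_subset)
  then have "bounded (Y' ` K)"
    by (intro compact_imp_bounded compact_continuous_image \<open>compact K\<close>)
  then obtain L where L: "\<And>p. p \<in> K \<Longrightarrow> norm (Y' p) \<le> L"
    by (auto simp: bounded_iff)
  have "0 \<le> L"
    using L[OF K[of 0 "u 0"]] r(1) norm_ge_zero[of "Y' (u 0)"] by (simp del: norm_ge_zero)
  have uc: "uniformly_continuous_on K Y'"
    by (rule compact_uniformly_continuous[OF cY \<open>compact K\<close>])
  show ?thesis
  proof
    show "\<exists>d>0. d \<le> r \<and> (\<forall>s\<in>{0..1}. \<forall>p\<in>cball (u s) d. norm (Y' p - Y' (u s)) \<le> \<eta>)" if "\<eta> > 0" for \<eta>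
    proof -
      obtain d where d: "d > 0" "\<And>p q. p \<in> K \<Longrightarrow> q \<in> K \<Longrightarrow> dist p q < d \<Longrightarrow> dist (Y' p) (Y' q) < \<eta>"
        using uc \<open>\<eta> > 0\<close> unfolding uniformly_continuous_on_def by metis
      show ?thesis
      proof (intro exI conjI ballI)
        fix s p assume "s \<in> {0..1::real}" "p \<in> cball (u s) (min r (d/2))"
        then have "dist (Y' p) (Y' (u s)) < \<eta>"
          using d(1) r(1) by (intro d(2) K[of s]) (auto simp: dist_commute)
        then show "norm (Y' p - Y' (u s)) \<le> \<eta>"
          by (simp add: dist_norm)
      qed (use d(1) r(1) in auto)
    qed
  qed (use r(1) \<open>0 \<le> L\<close> L K KU in auto)
qed

lemma C1_lipschitz_convex:
  assumes "C1_on U Y Y'" "convex S" "S \<subseteq> U" "\<And>p. p \<in> S \<Longrightarrow> norm (Y' p) \<le> L" "x \<in> S" "y \<in> S"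
  shows "norm (Y x - Y y) \<le> L * norm (x - y)"
proof (rule differentiable_bound[OF assms(2)])
  show "(Y has_derivative blinfun_apply (Y' p)) (at p within S)" if "p \<in> S" for p
    using assms(3) that C1_onD(1)[OF assms(1)] by (blast intro: has_derivative_at_withinI)
qed (use assms in \<open>auto simp: norm_blinfun.rep_eq[symmetric]\<close>)

text \<open>A continuation argument: the Lipschitz bound holds only inside the tube around
  \<open>u\<close>, and nothing says beforehand that \<open>v\<close> stays there. Up to a first
  time at distance \<open>r\<close>, Gronwall keeps the distance below \<open>r\<close>, so there is
  no such time.\<close>

lemma trajectories_close:
  fixes u v :: "real \<Rightarrow> 'a::euclidean_space"
  assumes C1: "C1_on U Y Y'" and u: "solution_on U Y u" and v: "solution_on U Y v"
    and r: "\<And>s p. s \<in> {0..1} \<Longrightarrow> p \<in> cball (u s) r \<Longrightarrow> p \<in> U \<and> norm (Y' p) \<le> L"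
    and "0 \<le> L" and small: "exp (2 * L + 1) * norm (v 0 - u 0) < r" and t: "t \<in> {0..1}"
  shows "norm (v t - u t) \<le> exp (2 * L + 1) * norm (v 0 - u 0)"
proof -
  define E where "E = exp (2 * L + 1)"
  define z where "z s = v s - u s" for s
  have E1: "1 \<le> E" using \<open>0 \<le> L\<close> by (simp add: E_def)
  have E: "exp ((2 * L + 1) * s) \<le> E" if "s \<in> {0..1}" for s
    using that \<open>0 \<le> L\<close> by (simp add: E_def mult_left_le)
  have z: "(z has_vector_derivative Y (v s) - Y (u s)) (at s within {0..1})" if "s \<in> {0..1}" for s
    unfolding z_def using solution_onD(2)[OF u that] solution_onD(2)[OF v that]
    by (rule has_vector_derivative_diff[rotated])
  have est: "norm (z T) \<le> E * norm (z 0)" if T: "T \<in> {0..1}" and le: "\<And>s. s \<in> {0..T} \<Longrightarrow> norm (z s) \<le> r" for T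
  proof -
    have "(norm (z T))\<^sup>2 \<le> exp ((2 * L + 1) * T) * ((norm (z 0))\<^sup>2 + 0\<^sup>2 * T)"
    proof (rule gronwall_norm_square)
      fix s assume s: "s \<in> {0..T}"
      then have s01: "s \<in> {0..1}" using T by auto
      show "(z has_vector_derivative Y (v s) - Y (u s)) (at s within {0..T})"
        using z[OF s01] by (rule has_vector_derivative_within_subset) (use T in auto)
      have "norm (Y (v s) - Y (u s)) \<le> L * norm (v s - u s)"
        by (rule C1_lipschitz_convex[OF C1, of "cball (u s) r"])
          (use r[OF s01] le[OF s] in \<open>auto simp: z_def dist_norm norm_minus_commute intro: order_trans[OF norm_ge_zero]\<close>)
      then show "norm (Y (v s) - Y (u s)) \<le> L * norm (z s) + 0"
        by (simp add: z_def)
    qed (use T \<open>0 \<le> L\<close> in auto)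
    also have "\<dots> \<le> E * (norm (z 0))\<^sup>2"
      using E[OF T] by (simp add: mult_right_mono)
    \<comment> \<open>As \<open>E\<close> is at least 1, a second factor \<open>E\<close> may be
      spent to make the right side a square.\<close>
    also have "\<dots> \<le> E\<^sup>2 * (norm (z 0))\<^sup>2"
      using E1 by (intro mult_right_mono) (simp_all add: power2_eq_square)
    finally show ?thesis
      by (metis E1 norm_ge_zero order_trans power2_le_imp_le power_mult_distrib zero_le_mult_iff zero_le_one)
  qed
  have lt: "norm (z s) < r" if "s \<in> {0..1}" for s
  proof (rule ccontr)
    assume "\<not> norm (z s) < r"
    define B where "B = {0..1} \<inter> (\<lambda>s. norm (z s)) -` {r..}"
    have cz: "continuous_on {0..1} (\<lambda>s. norm (z s))"
      using z by (intro continuous_intros continuous_on_vector_derivative)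
    have "compact B"
      unfolding B_def using cz
      by (metis compact_Icc closed_atLeast closed_Int_compact compact_eq_bounded_closed bounded_closed_interval bounded_Int continuous_on_closed_vimage closed_atLeastAtMost Int_commute)
    moreover have "s \<in> B" using that \<open>\<not> norm (z s) < r\<close> by (simp add: B_def)
    ultimately obtain T where T: "T \<in> B" "\<And>s. s \<in> B \<Longrightarrow> T \<le> s"
      using compact_attains_inf[of B] by blast
    have T01: "T \<in> {0..1}" "r \<le> norm (z T)" using T(1) by (auto simp: B_def)
    have before: "norm (z s) < r" if "s \<in> {0..<T}" for s
      using T(2)[of s] that T01 by (force simp: B_def)
    have z0: "norm (z 0) < r"
      using small E1 unfolding E_def[symmetric] z_def[symmetric]
      by (smt (verit) mult_right_mono norm_ge_zero mult_cancel_right1)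
    have "T > 0" using z0 T01 by (cases "T = 0") auto
    \<comment> \<open>Strictly before \<open>T\<close> the curve is inside the tube; the limit from
      the left puts time \<open>T\<close> itself in the closed tube, as \<open>est\<close>
      requires.\<close>
    have "norm (z T) \<le> r"
    proof (rule tendsto_upperbound)
      show "((\<lambda>s. norm (z s)) \<longlongrightarrow> norm (z T)) (at_left T)"
      proof -
        have "((\<lambda>s. norm (z s)) \<longlongrightarrow> norm (z T)) (at T within {0..1})"
          using cz T01 by (simp add: continuous_on_def)
        then have "((\<lambda>s. norm (z s)) \<longlongrightarrow> norm (z T)) (at T within {0..T})"
          by (rule tendsto_within_subset) (use T01 in auto)
        then show ?thesis using \<open>T > 0\<close> by (simp add: at_within_Icc_at_left)
      qed
      show "\<forall>\<^sub>F s in at_left T. norm (z s) \<le> r"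
        using eventually_at_left_real[OF \<open>T > 0\<close>] before
        by (auto elim!: eventually_mono intro: less_imp_le)
    qed simp
    then have "norm (z T) \<le> E * norm (z 0)"
      using before by (intro est T01) (metis atLeastAtMost_iff atLeastLessThan_iff less_imp_le order_le_less)
    then show False using small T01 by (simp add: E_def z_def)
  qed
  show ?thesis
    using est[OF t] lt t by (force simp: E_def z_def intro: less_imp_le)
qed

text \<open>Run backward, the two curves start at the same point, and the closeness estimate with
  initial distance 0 keeps them together.\<close>

lemma solutions_eq_backward:
  fixes u v :: "real \<Rightarrow> 'a::euclidean_space"
  assumes "open U" and C1: "C1_on U Y Y'" and u: "solution_on U Y u" and v: "solution_on U Y v"
    and eq: "u 1 = v 1"
  shows "u 0 = v 0"
proof -
  let ?u = "\<lambda>s. u (1 - s)" and ?v = "\<lambda>s. v (1 - s)"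
  note C1' = C1_on_scaleR[OF C1, of "- 1"]
  note u' = solution_on_reverse[OF u] and v' = solution_on_reverse[OF v]
  have "?u ` {0..1} \<subseteq> U"
    using solution_onD(1)[OF u'] by blast
  then obtain r L where rL: "0 < r" "0 \<le> L"
    "\<And>s p. s \<in> {0..1} \<Longrightarrow> p \<in> cball (?u s) r \<Longrightarrow> p \<in> U \<and> norm (- 1 *\<^sub>R Y' p) \<le> L"
    using trajectory_tube[OF \<open>open U\<close> solution_on_continuous[OF u'] _ C1_onD(2)[OF C1']] by metis
  have "norm (?v 1 - ?u 1) \<le> exp (2 * L + 1) * norm (?v 0 - ?u 0)"
    by (rule trajectories_close[OF C1' u' v' rL(3) rL(2)]) (use eq rL(1) in auto)
  then show ?thesis
    using eq by simp
qed

text \<open>The error \<open>z\<close> of the linear approximation solves the variational equation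
  along the trajectory of \<open>x\<close> up to a remainder that is small relative to
  \<open>norm (y - x)\<close>. Since \<open>z 0 = 0\<close>, Gronwall carries this smallness to time
  1.\<close>

lemma time_one_map_has_derivative:
  fixes \<psi> :: "real \<Rightarrow> 'a::euclidean_space \<Rightarrow> 'a"
  assumes "open U" and C1: "C1_on U Y Y'"
    and \<psi>: "\<And>y. y \<in> A \<Longrightarrow> \<psi> 0 y = y \<and> solution_on U Y (\<lambda>s. \<psi> s y)"
    and x: "x \<in> A"
    and W0: "W 0 = id_blinfun"
    and W: "\<And>s. s \<in> {0..1} \<Longrightarrow> (W has_vector_derivative Y' (\<psi> s x) o\<^sub>L W s) (at s within {0..1})"
  shows "(\<psi> 1 has_derivative W 1) (at x within A)"
  unfolding has_derivative_within_alt
proof (intro conjI allI impI)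
  fix e :: real assume "e > 0"
  let ?u = "\<lambda>s. \<psi> s x"
  have u: "solution_on U Y ?u" "\<psi> 0 x = x"
    using \<psi>[OF x] by auto
  have "?u ` {0..1} \<subseteq> U"
    using solution_onD(1)[OF u(1)] by blast
  then obtain r L where rL: "0 < r" "0 \<le> L"
    and tube: "\<And>s p. s \<in> {0..1} \<Longrightarrow> p \<in> cball (?u s) r \<Longrightarrow> p \<in> U \<and> norm (Y' p) \<le> L"
    and unif: "\<And>\<eta>. \<eta> > 0 \<Longrightarrow>
      \<exists>d>0. d \<le> r \<and> (\<forall>s\<in>{0..1}. \<forall>p\<in>cball (?u s) d. norm (Y' p - Y' (?u s)) \<le> \<eta>)"
    using trajectory_tube[OF \<open>open U\<close> solution_on_continuous[OF u(1)] _ C1_onD(2)[OF C1]] by metis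
  define E where "E = exp (2 * L + 1)"
  have "E > 0" by (simp add: E_def)
  \<comment> \<open>One factor \<open>E\<close> comes from the distance between the two
    trajectories, the other from the Gronwall constant.\<close>
  define \<eta> where "\<eta> = e / E\<^sup>2"
  have "\<eta> > 0" using \<open>e > 0\<close> \<open>E > 0\<close> by (simp add: \<eta>_def)
  then obtain d where d: "0 < d" "d \<le> r"
    "\<And>s p. s \<in> {0..1} \<Longrightarrow> p \<in> cball (?u s) d \<Longrightarrow> norm (Y' p - Y' (?u s)) \<le> \<eta>"
    using unif by meson
  show "\<exists>\<delta>>0. \<forall>y\<in>A. norm (y - x) < \<delta> \<longrightarrow> norm (\<psi> 1 y - \<psi> 1 x - W 1 (y - x)) \<le> e * norm (y - x)"
  proof (intro exI[of _ "d / E"] conjI ballI impI)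
    fix y assume y: "y \<in> A" "norm (y - x) < d / E"
    let ?v = "\<lambda>s. \<psi> s y"
    have v: "solution_on U Y ?v" "\<psi> 0 y = y"
      using \<psi>[OF y(1)] by auto
    have small: "E * norm (y - x) < d"
      using y(2) \<open>E > 0\<close> by (simp add: field_simps)
    have close: "norm (?v s - ?u s) \<le> E * norm (y - x)" if "s \<in> {0..1}" for s
      using trajectories_close[OF C1 u(1) v(1) tube rL(2) _ that] small d(2)
      by (simp add: u(2) v(2) E_def)
    define z where "z s = ?v s - ?u s - W s (y - x)" for s
    define z' where "z' s = Y (?v s) - Y (?u s) - Y' (?u s) (W s (y - x))" for s
    have "(norm (z 1))\<^sup>2 \<le> exp ((2 * L + 1) * 1) * ((norm (z 0))\<^sup>2 + (\<eta> * (E * norm (y - x)))\<^sup>2 * 1)"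
    proof (rule gronwall_norm_square)
      fix s :: real assume s: "s \<in> {0..1}"
      have "((\<lambda>s. W s (y - x)) has_vector_derivative Y' (?u s) (W s (y - x))) (at s within {0..1})"
        using bounded_linear.has_vector_derivative[OF blinfun.bounded_linear_left W[OF s], of "y - x"]
        by simp
      then show "(z has_vector_derivative z' s) (at s within {0..1})"
        unfolding z_def z'_def
        by (intro has_vector_derivative_diff solution_onD(2)[OF u(1) s] solution_onD(2)[OF v(1) s])
      let ?k = "?v s - ?u s"
      have "norm (Y (?v s) - Y (?u s) - Y' (?u s) ?k) \<le> norm ?k * \<eta>"
      proof (rule differentiable_bound_linearization[where S = "cball (?u s) d"
            and f' = "\<lambda>p. blinfun_apply (Y' p)"])
        show "?u s + t *\<^sub>R ?k \<in> cball (?u s) d" if "t \<in> {0..1}" for t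
        proof -
          have "norm (t *\<^sub>R ?k) \<le> norm ?k"
            using that by (simp add: mult_left_le_one_le)
          then show ?thesis
            using close[OF s] small by (simp add: dist_norm)
        qed
        show "(Y has_derivative Y' p) (at p within cball (?u s) d)" if "p \<in> cball (?u s) d" for p
          using tube[OF s, of p] that d(2) C1_onD(1)[OF C1] by (auto intro: has_derivative_at_withinI)
        show "onorm (blinfun_apply (Y' p) - blinfun_apply (Y' (?u s))) \<le> \<eta>" if "p \<in> cball (?u s) d" for p
          using d(3)[OF s that] by (simp add: norm_blinfun.rep_eq minus_blinfun.rep_eq fun_diff_def)
        show "?u s \<in> cball (?u s) d"
          using d(1) by simp
      qed
      also have "\<dots> \<le> \<eta> * (E * norm (y - x))"
        using close[OF s] \<open>\<eta> > 0\<close> by (simp add: mult.commute mult_right_mono)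
      finally have rest: "norm (Y (?v s) - Y (?u s) - Y' (?u s) ?k) \<le> \<eta> * (E * norm (y - x))" .
      have "norm (Y' (?u s) (z s)) \<le> norm (Y' (?u s)) * norm (z s)"
        by (rule norm_blinfun)
      also have "\<dots> \<le> L * norm (z s)"
        using tube[OF s, of "?u s"] rL(1) by (intro mult_right_mono) auto
      finally have lin: "norm (Y' (?u s) (z s)) \<le> L * norm (z s)" .
      have "z' s = Y' (?u s) (z s) + (Y (?v s) - Y (?u s) - Y' (?u s) ?k)"
        by (simp add: z_def z'_def blinfun.diff_right)
      then show "norm (z' s) \<le> L * norm (z s) + \<eta> * (E * norm (y - x))"
        using lin rest by (metis add_mono norm_triangle_ineq order_trans)
    qed (use rL \<open>\<eta> > 0\<close> \<open>E > 0\<close> in auto)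
    also have "\<dots> = E * (\<eta> * (E * norm (y - x)))\<^sup>2"
      by (simp add: z_def u(2) v(2) W0 E_def)
    also have "\<dots> \<le> E\<^sup>2 * (\<eta> * (E * norm (y - x)))\<^sup>2"
      using rL by (intro mult_right_mono) (simp_all add: E_def power2_eq_square)
    also have "\<dots> = (e * norm (y - x))\<^sup>2"
      using \<open>E > 0\<close> by (simp add: \<eta>_def power2_eq_square field_simps)
    finally show "norm (\<psi> 1 y - \<psi> 1 x - W 1 (y - x)) \<le> e * norm (y - x)"
      unfolding z_def by (rule power2_le_imp_le) (use \<open>e > 0\<close> in simp)
  qed (use d(1) \<open>E > 0\<close> in simp)
qed (rule blinfun.bounded_linear_right)

section \<open>Fundamental solution of a linear differential equation\<close>

text \<open>Picard iteration in series form: \<open>P n\<close> is the \<open>n\<close>-fold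
  iterated integral, and the sum converges uniformly by the Weierstrass test. The series of
  derivatives is \<open>A s\<close> composed with the shifted series, so it converges uniformly
  too.\<close>

lemma linear_ode_exists:
  fixes A :: "real \<Rightarrow> 'a::euclidean_space \<Rightarrow>\<^sub>L 'a"
  assumes A: "continuous_on {0..1} A"
  obtains W where "W 0 = id_blinfun"
    "\<And>s. s \<in> {0..1} \<Longrightarrow> (W has_vector_derivative A s o\<^sub>L W s) (at s within {0..1})"
proof -
  define P where "P = rec_nat (\<lambda>_. id_blinfun) (\<lambda>_ p s. integral {0..s} (\<lambda>r. A r o\<^sub>L p r))"
  have P0: "P 0 = (\<lambda>_. id_blinfun)" and PS: "P (Suc n) = (\<lambda>s. integral {0..s} (\<lambda>r. A r o\<^sub>L P n r))" for n
    by (simp_all add: P_def)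
  \<comment> \<open>The derivatives of the \<open>P n\<close>. The value 0 at index 0 belongs to the
    constant identity; it makes the partial sum of \<open>Q\<close> below \<open>Suc n\<close> equal
    to \<open>A s\<close> composed with the partial sum of \<open>P\<close> below
    \<open>n\<close>.\<close>
  define Q where "Q n = (\<lambda>s. case n of 0 \<Rightarrow> 0 | Suc m \<Rightarrow> A s o\<^sub>L P m s)" for n
  have Pc: "continuous_on {0..1} (P n)"
    and Pd: "s \<in> {0..1} \<Longrightarrow> (P n has_vector_derivative Q n s) (at s within {0..1})" for n s
  proof (induction n arbitrary: s)
    case 0
    { case 1 show ?case by (simp add: P0) }
    { case 2 show ?case by (simp add: P0 Q_def) }
  next
    case (Suc n)
    have d: "(P (Suc n) has_vector_derivative Q (Suc n) s) (at s within {0..1})" if "s \<in> {0..1}" for s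
      unfolding PS Q_def using integral_has_vector_derivative[OF _ that, of "\<lambda>r. A r o\<^sub>L P n r"]
      by (simp add: A Suc continuous_intros)
    { case 1 show ?case using d by (rule continuous_on_vector_derivative) }
    { case 2 then show ?case by (rule d) }
  qed
  have "bounded (A ` {0..1})"
    using A by (intro compact_imp_bounded compact_continuous_image) auto
  then obtain L where L: "\<And>s. s \<in> {0..1} \<Longrightarrow> norm (A s) \<le> L"
    unfolding bounded_iff by blast
  have "0 \<le> L" using L[of 0] norm_ge_zero[of "A 0"] by (simp del: norm_ge_zero)
  \<comment> \<open>The exponential weight makes the Picard iteration contract by the factor 1/2.\<close>
  have Pn: "norm (P n s) \<le> exp (2 * L * s) * (1/2) ^ n" if "s \<in> {0..1}" for n s
    using that
  proof (induction n arbitrary: s)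
    case 0
    have "norm (P 0 s) \<le> 1"
      unfolding P0 by (simp add: norm_blinfun_id_le)
    also have "1 \<le> exp (2 * L * s)"
      using 0 \<open>0 \<le> L\<close> by simp
    finally show ?case by simp
  next
    case (Suc n)
    have int: "((\<lambda>r. L * (exp (2 * L * r) * (1/2) ^ n)) has_integral
       (exp (2 * L * s) * (1/2) ^ Suc n - exp (2 * L * 0) * (1/2) ^ Suc n)) {0..s}"
      using Suc.prems
      by (intro fundamental_theorem_of_calculus)
        (auto intro!: derivative_eq_intros simp: has_real_derivative_iff_has_vector_derivative[symmetric])
    have "norm (P (Suc n) s) \<le> integral {0..s} (\<lambda>r. L * (exp (2 * L * r) * (1/2) ^ n))"
      unfolding PS
    proof (rule integral_norm_bound_integral)
      show "(\<lambda>r. A r o\<^sub>L P n r) integrable_on {0..s}"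
        using Suc.prems
        by (intro integrable_continuous_real continuous_intros continuous_on_subset[OF A] continuous_on_subset[OF Pc]) auto
      fix r assume r: "r \<in> {0..s}"
      have "norm (A r o\<^sub>L P n r) \<le> norm (A r) * norm (P n r)"
        by (rule norm_blinfun_compose)
      also have "\<dots> \<le> L * (exp (2 * L * r) * (1/2) ^ n)"
        using r Suc.prems \<open>0 \<le> L\<close> by (intro mult_mono L Suc.IH) auto
      finally show "norm (A r o\<^sub>L P n r) \<le> L * (exp (2 * L * r) * (1/2) ^ n)" .
    qed (use int in blast)
    also have "\<dots> = exp (2 * L * s) * (1/2) ^ Suc n - exp (2 * L * 0) * (1/2) ^ Suc n"
      using int by (rule integral_unique)
    also have "\<dots> \<le> exp (2 * L * s) * (1/2) ^ Suc n"
      by simp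
    finally show ?case .
  qed
  define M where "M n = exp (2 * L) * (1/2) ^ n" for n :: nat
  have PM: "norm (P n s) \<le> M n" if "s \<in> {0..1}" for n s
  proof -
    have "exp (2 * L * s) \<le> exp (2 * L)"
      using that \<open>0 \<le> L\<close> by (simp add: mult_left_le)
    then show ?thesis using Pn[OF that, of n] unfolding M_def
      by (meson mult_right_mono order_trans zero_le_power divide_nonneg_nonneg zero_le_one zero_le_numeral)
  qed
  have sM: "summable M"
    unfolding M_def by (intro summable_mult summable_geometric) simp
  define W where "W s = (\<Sum>n. P n s)" for s
  have Psums: "(\<lambda>n. P n s) sums W s" if "s \<in> {0..1}" for s
    unfolding W_def using summable_comparison_test'[OF sM, of 0 "\<lambda>n. P n s"] PM[OF that]
    by (simp add: summable_sums)
  have uP: "uniform_limit {0..1} (\<lambda>n s. \<Sum>i<n. P i s) W sequentially"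
    unfolding W_def[abs_def] by (rule Weierstrass_m_test[OF PM sM])
  have uQ: "\<forall>\<^sub>F n in sequentially. \<forall>s\<in>{0..1}. \<forall>h::real.
      norm ((\<Sum>i<n. h *\<^sub>R Q i s) - h *\<^sub>R (A s o\<^sub>L W s)) \<le> e * norm h" if "e > 0" for e
  proof -
    \<comment> \<open>Dividing by \<open>L + 1\<close> instead of \<open>L\<close> covers the case
      \<open>L = 0\<close>.\<close>
    have "e / (L + 1) > 0" using \<open>e > 0\<close> \<open>0 \<le> L\<close> by simp
    then have "\<forall>\<^sub>F n in sequentially. \<forall>s\<in>{0..1}. dist (\<Sum>i<n. P i s) (W s) < e / (L + 1)"
      using uP by (rule uniform_limitD[rotated])
    then have "\<forall>\<^sub>F n in sequentially. \<forall>s\<in>{0..1}. \<forall>h::real.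
      norm ((\<Sum>i<Suc n. h *\<^sub>R Q i s) - h *\<^sub>R (A s o\<^sub>L W s)) \<le> e * norm h"
    proof (rule eventually_mono, intro ballI allI)
      fix n s and h :: real
      assume *: "\<forall>s\<in>{0..1}. dist (\<Sum>i<n. P i s) (W s) < e / (L + 1)" and s: "s \<in> {0..1::real}"
      have "(\<Sum>i<Suc n. h *\<^sub>R Q i s) - h *\<^sub>R (A s o\<^sub>L W s) = h *\<^sub>R (A s o\<^sub>L ((\<Sum>i<n. P i s) - W s))"
        unfolding sum.lessThan_Suc_shift
        by (simp add: Q_def scaleR_sum_right
            bounded_bilinear.sum_right[OF bounded_bilinear_blinfun_compose]
            bounded_bilinear.diff_right[OF bounded_bilinear_blinfun_compose] scaleR_diff_right)
      also have "norm \<dots> \<le> \<bar>h\<bar> * (norm (A s) * norm ((\<Sum>i<n. P i s) - W s))"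
        by (simp add: mult_left_mono norm_blinfun_compose)
      also have "\<dots> \<le> \<bar>h\<bar> * ((L + 1) * (e / (L + 1)))"
        using * s L[OF s] \<open>0 \<le> L\<close> by (intro mult_left_mono mult_mono) (auto simp: dist_norm intro: less_imp_le)
      finally show "norm ((\<Sum>i<Suc n. h *\<^sub>R Q i s) - h *\<^sub>R (A s o\<^sub>L W s)) \<le> e * norm h"
        using \<open>0 \<le> L\<close> by (simp add: mult.commute)
    qed
    then show ?thesis by (rule eventually_sequentially_Suc[THEN iffD1])
  qed
  \<comment> \<open>Termwise differentiation yields a limit function known to agree with
    \<open>W\<close> on \<open>{0..1}\<close> only, so \<open>g\<close> serves as the
    witness.\<close>
  have "\<exists>g. \<forall>s\<in>{0..1}. (\<lambda>n. P n s) sums g s \<and> (g has_derivative (\<lambda>h. h *\<^sub>R (A s o\<^sub>L W s))) (at s within {0..1})"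
  proof (rule has_derivative_series[where f' = "\<lambda>n s h. h *\<^sub>R Q n s"])
    show "(P n has_derivative (\<lambda>h. h *\<^sub>R Q n s)) (at s within {0..1})" if "s \<in> {0..1}" for n s
      using Pd[OF that] by (simp add: has_vector_derivative_def)
  qed (use uQ Psums[of 0] in auto)
  then obtain g where g: "\<And>s. s \<in> {0..1} \<Longrightarrow> (\<lambda>n. P n s) sums g s"
    "\<And>s. s \<in> {0..1} \<Longrightarrow> (g has_derivative (\<lambda>h. h *\<^sub>R (A s o\<^sub>L W s))) (at s within {0..1})"
    by blast
  have gW: "g s = W s" if "s \<in> {0..1}" for s
    using sums_unique2[OF g(1)[OF that] Psums[OF that]] .
  show ?thesis
  proof
    have "P n 0 = 0" if "n \<noteq> 0" for n
      using that by (cases n) (simp_all add: PS)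
    then have "(\<lambda>n. P n 0) sums P 0 0"
      using sums_finite[of "{0}" "\<lambda>n. P n 0"] by simp
    then show "g 0 = id_blinfun"
      using sums_unique2[OF g(1)[of 0]] by (simp add: P0)
    show "(g has_vector_derivative A s o\<^sub>L g s) (at s within {0..1})" if "s \<in> {0..1}" for s
      using g(2)[OF that] by (simp add: gW[OF that] has_vector_derivative_def)
  qed
qed

section \<open>Determinants and traces in Euclidean spaces\<close>

text \<open>The product rule in the Leibniz formula: the summands in which row \<open>k\<close> is
  differentiated reassemble to a determinant with that row replaced.\<close>

lemma has_derivative_det:
  fixes M :: "'a::real_normed_vector \<Rightarrow> real^'n^'n"
  assumes M: "\<And>i j. ((\<lambda>x. M x $ i $ j) has_derivative (\<lambda>h. M' h $ i $ j)) (at x within S)"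
  shows "((\<lambda>x. det (M x)) has_derivative
    (\<lambda>h. \<Sum>k\<in>UNIV. det (\<chi> i. if i = k then M' h $ k else M x $ i))) (at x within S)"
proof -
  have eq: "(\<Sum>p\<in>{p. p permutes UNIV}. of_int (sign p) * (\<Sum>k\<in>UNIV. M' h $ k $ p k * (\<Prod>i\<in>UNIV - {k}. M x $ i $ p i)))
      = (\<Sum>k\<in>UNIV. det (\<chi> i. if i = k then M' h $ k else M x $ i))" for h
  proof -
    have "(\<Prod>i\<in>UNIV. (\<chi> i. if i = k then M' h $ k else M x $ i) $ i $ p i)
        = M' h $ k $ p k * (\<Prod>i\<in>UNIV - {k}. M x $ i $ p i)" for k and p :: "'n \<Rightarrow> 'n"
      by (subst prod.remove[of UNIV k]) (auto intro!: prod.cong)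
    then show ?thesis
      unfolding det_def sum_distrib_left by (subst sum.swap) simp
  qed
  show ?thesis
    unfolding eq[symmetric] unfolding det_def
    by (auto intro!: derivative_eq_intros M)
qed

text \<open>Row \<open>k\<close> of \<open>B ** A\<close> is a combination of the rows of
  \<open>A\<close>; by Cramer's lemma only its multiple \<open>B $ k $ k\<close> of row
  \<open>k\<close> contributes. With \<open>has_derivative_det\<close> this is Jacobi's formula for
  a derivative \<open>B ** A\<close>, used both for the variational equation and for the Gram
  matrix.\<close>

lemma jacobi_row_sum:
  fixes A B :: "real^'n^'n"
  shows "(\<Sum>k\<in>UNIV. det (\<chi> i. if i = k then (B ** A) $ k else A $ i)) = trace B * det A"
proof -
  have "det (\<chi> i. if i = k then (B ** A) $ k else A $ i) = B $ k $ k * det A" for k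
  proof -
    have "(B ** A) $ k = (\<Sum>j\<in>UNIV. B $ k $ j *s row j A)"
      by (simp add: vec_eq_iff matrix_matrix_mult_def row_def)
    then show ?thesis
      using cramer_lemma_transpose[of k "B $ k" A] by (simp add: row_def cong: if_cong)
  qed
  then show ?thesis
    by (simp add: trace_def sum_distrib_right)
qed

text \<open>The change of variables theorem of the library is about real vectors with a well-ordered
  finite index type; the following index type transports it to any Euclidean space.\<close>

typedef (overloaded) 'a coord = "{..<DIM('a::euclidean_space)}"
  by (auto intro: exI[of _ 0])

setup_lifting type_definition_coord

instantiation coord :: (euclidean_space) linorder
begin
lift_definition less_eq_coord :: "'a coord \<Rightarrow> 'a coord \<Rightarrow> bool" is "(\<le>)" .
lift_definition less_coord :: "'a coord \<Rightarrow> 'a coord \<Rightarrow> bool" is "(<)" .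
instance by standard (transfer; auto)+
end

instance coord :: (euclidean_space) wellorder
proof
  fix P :: "'a coord \<Rightarrow> bool" and a
  assume *: "\<And>x. (\<And>y. y < x \<Longrightarrow> P y) \<Longrightarrow> P x"
  show "P a"
    by (induction a rule: measure_induct_rule[of Rep_coord]) (metis * less_coord.rep_eq)
qed

lemma bij_betw_Rep_coord: "bij_betw Rep_coord (UNIV :: 'a::euclidean_space coord set) {..<DIM('a)}"
  by (simp add: bij_betw_def inj_on_def Rep_coord_inject type_definition.Rep_range[OF type_definition_coord])

instance coord :: (euclidean_space) finite
  by standard (metis bij_betw_finite bij_betw_Rep_coord finite_lessThan)

definition coord_basis :: "'a::euclidean_space coord \<Rightarrow> 'a"
  where "coord_basis = (SOME f. bij_betw f UNIV Basis)"

lemma bij_coord_basis: "bij_betw (coord_basis :: 'a::euclidean_space coord \<Rightarrow> 'a) UNIV Basis"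
proof -
  have "card (UNIV :: 'a coord set) = DIM('a)"
    using bij_betw_same_card[OF bij_betw_Rep_coord[where 'a='a]] by simp
  then have "\<exists>f :: 'a coord \<Rightarrow> 'a. bij_betw f UNIV Basis"
    by (intro finite_same_card_bij) auto
  then show ?thesis
    unfolding coord_basis_def by (rule someI_ex)
qed

lemma coord_basis_in_Basis [simp]: "coord_basis i \<in> Basis"
  using bij_coord_basis by (metis UNIV_I bij_betwE)

lemma inner_coord_basis: "coord_basis i \<bullet> coord_basis j = (if i = j then 1 else 0)"
  using bij_coord_basis by (auto simp: inner_Basis bij_betw_def dest: injD)

lemma sum_coord_basis: "(\<Sum>i\<in>UNIV. f (coord_basis i)) = (\<Sum>b\<in>Basis. f b)"
  by (rule sum.reindex_bij_betw[OF bij_coord_basis])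

lemma prod_coord_basis: "(\<Prod>i\<in>UNIV. f (coord_basis i)) = (\<Prod>b\<in>Basis. f b)"
  by (rule prod.reindex_bij_betw[OF bij_coord_basis])

definition coords :: "'a::euclidean_space \<Rightarrow> real^'a coord"
  where "coords x = (\<chi> i. x \<bullet> coord_basis i)"

definition uncoords :: "real^'a::euclidean_space coord \<Rightarrow> 'a"
  where "uncoords y = (\<Sum>i\<in>UNIV. (y $ i) *\<^sub>R coord_basis i)"

lemma uncoords_coords [simp]: "uncoords (coords x) = x"
  unfolding uncoords_def coords_def
  using sum_coord_basis[of "\<lambda>b. (x \<bullet> b) *\<^sub>R b"] by (simp add: euclidean_representation)

lemma uncoords_inner: "uncoords y \<bullet> coord_basis i = y $ i"
  by (simp add: uncoords_def inner_sum_left inner_coord_basis if_distrib[of "\<lambda>t. _ * t"] cong: if_cong)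

lemma coords_uncoords [simp]: "coords (uncoords y) = y"
  by (simp add: coords_def uncoords_inner)

lemma bounded_linear_coords: "bounded_linear coords"
  by (intro linear_conv_bounded_linear[THEN iffD1] linearI)
    (simp_all add: coords_def vec_eq_iff inner_add_left)

lemma bounded_linear_uncoords: "bounded_linear uncoords"
  by (intro linear_conv_bounded_linear[THEN iffD1] linearI)
    (simp_all add: uncoords_def algebra_simps sum.distrib scaleR_sum_right)

lemma borel_measurable_uncoords [measurable]: "uncoords \<in> borel_measurable borel"
  by (intro borel_measurable_continuous_onI linear_continuous_on bounded_linear_uncoords)

text \<open>In orthonormal coordinates boxes correspond to boxes with the same side lengths, and
  agreement on boxes characterises Lebesgue measure.\<close>

lemma distr_lborel_uncoords: "distr lborel borel uncoords = (lborel :: 'a::euclidean_space measure)"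
proof (rule lborel_eqI[symmetric])
  fix l u :: 'a assume le: "\<And>b. b \<in> Basis \<Longrightarrow> l \<bullet> b \<le> u \<bullet> b"
  have all: "(\<forall>b\<in>Basis. Q b) \<longleftrightarrow> (\<forall>i. Q (coord_basis i))" for Q :: "'a \<Rightarrow> bool"
    using bij_coord_basis unfolding bij_betw_def by (metis UNIV_I coord_basis_in_Basis imageE)
  have vim: "uncoords -` box l u = box (coords l) (coords u)"
    by (auto simp: box_def Basis_vec_def inner_axis coords_def uncoords_inner all)
  have "emeasure (distr lborel borel uncoords) (box l u) = emeasure lborel (box (coords l) (coords u))"
    by (subst emeasure_distr) (simp_all add: vim)
  also have "\<dots> = (\<Prod>b\<in>Basis. (coords u - coords l) \<bullet> b)"
    using le by (intro emeasure_lborel_box) (auto simp: Basis_vec_def inner_axis coords_def)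
  also have "(\<Prod>b\<in>Basis. (coords u - coords l) \<bullet> b) = (\<Prod>i\<in>UNIV. (u - l) \<bullet> coord_basis i)"
  proof -
    have B: "(Basis :: (real^'a coord) set) = range (\<lambda>i. axis i 1)"
      by (auto simp: Basis_vec_def)
    have inj: "inj (\<lambda>i::'a coord. axis i (1::real))"
      by (auto simp: inj_on_def axis_eq_axis)
    have "(\<Prod>b\<in>Basis. (coords u - coords l) \<bullet> b) = (\<Prod>i\<in>UNIV. (coords u - coords l) \<bullet> axis i 1)"
      unfolding B prod.reindex[OF inj] by simp
    then show ?thesis
      by (simp add: inner_axis coords_def inner_diff_left)
  qed
  also have "\<dots> = (\<Prod>b\<in>Basis. (u - l) \<bullet> b)"
    by (rule prod_coord_basis)
  finally show "emeasure (distr lborel borel uncoords) (box l u) = (\<Prod>b\<in>Basis. (u - l) \<bullet> b)" .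
qed simp

text \<open>The image of a Borel set under a differentiable map is available only as a Lebesgue
  measurable set, so the integrand is first replaced by a Borel function equal to it almost
  everywhere.\<close>

lemma nn_integral_uncoords:
  fixes h :: "'a::euclidean_space \<Rightarrow> ennreal"
  assumes "h \<in> borel_measurable lebesgue"
  shows "(\<integral>\<^sup>+y. h (uncoords y) \<partial>lborel) = (\<integral>\<^sup>+x. h x \<partial>lborel)"
proof -
  obtain h' where h': "h' \<in> borel_measurable lborel" "AE x in lborel. h x = h' x"
    using completion_ex_borel_measurable[OF assms] by blast
  have "AE x in distr lborel borel uncoords. h x = h' x"
    unfolding distr_lborel_uncoords by (rule h'(2))
  then have "AE y in lborel. h (uncoords y) = h' (uncoords y)"
    by (rule AE_distrD[rotated]) simp
  then have "(\<integral>\<^sup>+y. h (uncoords y) \<partial>lborel) = (\<integral>\<^sup>+y. h' (uncoords y) \<partial>lborel)"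
    by (rule nn_integral_cong_AE)
  also have "\<dots> = (\<integral>\<^sup>+x. h' x \<partial>distr lborel borel uncoords)"
    using h'(1) by (subst nn_integral_distr) auto
  also have "\<dots> = (\<integral>\<^sup>+x. h' x \<partial>lborel)"
    by (simp only: distr_lborel_uncoords)
  also have "\<dots> = (\<integral>\<^sup>+x. h x \<partial>lborel)"
    using h'(2) by (intro nn_integral_cong_AE) auto
  finally show ?thesis .
qed

section \<open>Matrix, determinant and trace of an endomorphism\<close>

definition lin_matrix :: "('a::euclidean_space \<Rightarrow> 'a) \<Rightarrow> real^'a coord^'a coord"
  where "lin_matrix f = (\<chi> i j. f (coord_basis j) \<bullet> coord_basis i)"

definition lin_det :: "('a::euclidean_space \<Rightarrow> 'a) \<Rightarrow> real"
  where "lin_det f = det (lin_matrix f)"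

definition lin_trace :: "('a::euclidean_space \<Rightarrow> 'a) \<Rightarrow> real"
  where "lin_trace f = (\<Sum>b\<in>Basis. f b \<bullet> b)"

lemma trace_lin_matrix: "trace (lin_matrix f) = lin_trace f"
  unfolding trace_def lin_matrix_def lin_trace_def
  using sum_coord_basis[of "\<lambda>b. f b \<bullet> b"] by simp

lemma lin_det_id: "lin_det (\<lambda>x. x) = 1"
proof -
  have "lin_matrix (\<lambda>x::'a. x) = mat 1"
    by (auto simp: lin_matrix_def mat_def vec_eq_iff inner_coord_basis)
  then show ?thesis
    by (simp add: lin_det_def)
qed

lemma lin_matrix_compose:
  assumes "linear f"
  shows "lin_matrix (\<lambda>x. f (g x)) = lin_matrix f ** lin_matrix g"
proof -
  have "f (g b) \<bullet> c = (\<Sum>i\<in>UNIV. (f (coord_basis i) \<bullet> c) * (g b \<bullet> coord_basis i))" for b c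
  proof -
    have "g b = (\<Sum>i\<in>UNIV. (g b \<bullet> coord_basis i) *\<^sub>R coord_basis i)"
      using uncoords_coords[of "g b"] by (simp add: uncoords_def coords_def)
    then have "f (g b) = (\<Sum>i\<in>UNIV. (g b \<bullet> coord_basis i) *\<^sub>R f (coord_basis i))"
      by (metis (no_types, lifting) assms linear_scale linear_sum sum.cong)
    then show ?thesis
      by (simp add: inner_sum_left mult.commute)
  qed
  then show ?thesis
    by (simp add: vec_eq_iff lin_matrix_def matrix_matrix_mult_def)
qed

lemma matrix_coords: "matrix (\<lambda>y. coords (f (uncoords y))) = lin_matrix f"
proof -
  have "uncoords (axis j 1) = coord_basis j" for j :: "'a coord"
    by (simp add: uncoords_def axis_def if_distrib[of "\<lambda>t. t *\<^sub>R _"] cong: if_cong)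
  then show ?thesis
    by (simp add: matrix_def lin_matrix_def coords_def)
qed

text \<open>Liouville's formula for the Wronskian. The matrix of \<open>W\<close> obeys the same
  equation as \<open>W\<close>, because passing to matrices is linear and turns composition into the
  product; Jacobi's formula then applies.\<close>

lemma has_real_derivative_lin_det:
  fixes W :: "real \<Rightarrow> 'a::euclidean_space \<Rightarrow>\<^sub>L 'a"
  assumes "(W has_vector_derivative B o\<^sub>L W s) (at s within S)"
  shows "((\<lambda>s. lin_det (W s)) has_real_derivative lin_trace B * lin_det (W s)) (at s within S)"
proof -
  have "((\<lambda>s. lin_matrix (W s) $ i $ j) has_derivative
      (\<lambda>h. (h *\<^sub>R lin_matrix (B o\<^sub>L W s)) $ i $ j)) (at s within S)" for i j
  proof -
    have "bounded_linear (\<lambda>V::'a \<Rightarrow>\<^sub>L 'a. lin_matrix V $ i $ j)"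
      unfolding lin_matrix_def by (simp add: bounded_linear_inner_left_comp blinfun.bounded_linear_left)
    from bounded_linear.has_vector_derivative[OF this assms]
    show ?thesis
      by (simp add: has_vector_derivative_def)
  qed
  from has_derivative_det[OF this]
  have "((\<lambda>s. lin_det (W s)) has_derivative (\<lambda>h. \<Sum>k\<in>UNIV. det
      (\<chi> i. if i = k then h *s (lin_matrix (B o\<^sub>L W s) $ k) else lin_matrix (W s) $ i))) (at s within S)"
    by (simp add: lin_det_def scalar_mult_eq_scaleR cong: if_cong)
  moreover have "lin_matrix (B o\<^sub>L W s) = lin_matrix B ** lin_matrix (W s)"
    using lin_matrix_compose[OF bounded_linear.linear[OF blinfun.bounded_linear_right], of B "W s"]
    by (simp add: blinfun_compose.rep_eq o_def)
  ultimately show ?thesis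
    by (simp add: has_field_derivative_def det_row_mul sum_distrib_left[symmetric] jacobi_row_sum
        trace_lin_matrix lin_det_def mult_commute_abs cong: if_cong)
qed

section \<open>Change of variables\<close>

text \<open>Bridge between the change of variables theorem, which speaks of absolute integrability
  and \<open>integral\<close>, and the nonnegative integrals of
  \<open>invariant_measure\<close>.\<close>

lemma absolutely_integrable_on_iff_nn_integral:
  fixes f :: "'a::euclidean_space \<Rightarrow> real"
  assumes S: "S \<in> sets lebesgue" and f: "f \<in> borel_measurable (lebesgue_on S)"
    and nonneg: "\<And>x. x \<in> S \<Longrightarrow> 0 \<le> f x"
  shows "f absolutely_integrable_on S \<longleftrightarrow> (\<integral>\<^sup>+x\<in>S. ennreal (f x) \<partial>lborel) < \<infinity>"
    and "f absolutely_integrable_on S \<Longrightarrow> (\<integral>\<^sup>+x\<in>S. ennreal (f x) \<partial>lborel) = ennreal (integral S f)"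
proof -
  let ?h = "\<lambda>x. indicator S x *\<^sub>R f x"
  have m: "?h \<in> borel_measurable lebesgue"
    using f S by (simp add: borel_measurable_restrict_space_iff mult.commute)
  have eq: "(\<integral>\<^sup>+x\<in>S. ennreal (f x) \<partial>lborel) = (\<integral>\<^sup>+x. ennreal (?h x) \<partial>lebesgue)"
    unfolding nn_integral_completion by (intro nn_integral_cong) (simp add: indicator_def)
  have nn: "0 \<le> ?h x" for x
    using nonneg by (simp add: indicator_def)
  show "f absolutely_integrable_on S \<longleftrightarrow> (\<integral>\<^sup>+x\<in>S. ennreal (f x) \<partial>lborel) < \<infinity>"
    unfolding set_integrable_def eq using m nn by (simp add: integrable_iff_bounded)
  assume int: "f absolutely_integrable_on S"
  then have "(\<integral>\<^sup>+x. ennreal (?h x) \<partial>lebesgue) = ennreal (integral\<^sup>L lebesgue ?h)"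
    unfolding set_integrable_def using nn by (intro nn_integral_eq_integral) auto
  then show "(\<integral>\<^sup>+x\<in>S. ennreal (f x) \<partial>lborel) = ennreal (integral S f)"
    using set_lebesgue_integral_eq_integral(2)[OF int] by (simp add: eq set_lebesgue_integral_def)
qed

lemma nn_integral_change_of_variables_cart:
  fixes g :: "real^'m::{finite,wellorder} \<Rightarrow> real^'m::_" and f :: "real^'m::_ \<Rightarrow> real"
  assumes S: "S \<in> sets lebesgue"
    and der: "\<And>x. x \<in> S \<Longrightarrow> (g has_derivative g' x) (at x within S)"
    and inj: "inj_on g S"
    and f: "f \<in> borel_measurable (lebesgue_on (g ` S))" and nonneg: "\<And>x. x \<in> g ` S \<Longrightarrow> 0 \<le> f x"
    and fg: "(\<lambda>x. \<bar>det (matrix (g' x))\<bar> * f (g x)) \<in> borel_measurable (lebesgue_on S)"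
  shows "(\<integral>\<^sup>+x\<in>g ` S. ennreal (f x) \<partial>lborel)
    = (\<integral>\<^sup>+x\<in>S. ennreal (\<bar>det (matrix (g' x))\<bar> * f (g x)) \<partial>lborel)"
proof -
  let ?D = "\<lambda>x. \<bar>det (matrix (g' x))\<bar> * f (g x)"
  have gS: "g ` S \<in> sets lebesgue"
    by (rule differentiable_image_in_sets_lebesgue[OF S])
      (use der in \<open>auto simp: differentiable_on_def differentiable_def\<close>)
  \<comment> \<open>The theorem takes vector-valued integrands, so the scalar one is carried by
    \<open>real^1\<close>. Being an equivalence with integrability on both sides, it also settles
    the infinite case: if one side is not integrable, both nonnegative integrals are
    infinite.\<close>
  have cv: "?D absolutely_integrable_on S \<and> integral S ?D = b
    \<longleftrightarrow> f absolutely_integrable_on g ` S \<and> integral (g ` S) f = b" for b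
    using has_absolute_integral_change_of_variables[OF S der inj, of "\<lambda>x. vec (f x) :: real^1" "vec b"]
    by (simp add: absolutely_integrable_on_1_iff integral_on_1_eq vec_eq_iff)
  note F = absolutely_integrable_on_iff_nn_integral[OF gS f nonneg]
  note D = absolutely_integrable_on_iff_nn_integral[OF S fg]
  have nnD: "\<And>x. x \<in> S \<Longrightarrow> 0 \<le> ?D x"
    using nonneg by auto
  show ?thesis
  proof (cases "f absolutely_integrable_on g ` S")
    case True
    then show ?thesis
      using cv[of "integral (g ` S) f"] F(2) D(2)[OF nnD] by simp
  next
    case False
    then have "\<not> ?D absolutely_integrable_on S"
      using cv by blast
    then show ?thesis
      using False F(1) D(1)[OF nnD] by (simp add: not_less top_unique)
  qed
qed

lemma lebesgue_coords_image:
  assumes "A \<in> sets lebesgue"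
  shows "coords ` A \<in> sets lebesgue"
proof (rule differentiable_image_in_sets_lebesgue[OF assms])
  show "DIM('a) \<le> DIM(real^'a coord)"
    using bij_betw_same_card[OF bij_coord_basis[where 'a='a]] by simp
qed (rule bounded_linear_imp_differentiable_on[OF bounded_linear_coords])

lemma uncoords_vimage: "uncoords -` A = coords ` A"
  by (auto simp: image_iff) (metis coords_uncoords)

lemma borel_measurable_uncoords_lebesgue_on:
  assumes "f \<in> borel_measurable (lebesgue_on S)"
  shows "(\<lambda>y. f (uncoords y)) \<in> borel_measurable (lebesgue_on (coords ` S))"
proof -
  have "uncoords \<in> lebesgue \<rightarrow>\<^sub>M lebesgue"
    by (rule measurableI) (auto simp: uncoords_vimage lebesgue_coords_image)
  then have "uncoords \<in> lebesgue_on (coords ` S) \<rightarrow>\<^sub>M lebesgue_on S"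
    by (intro measurable_restrict_space2 measurable_restrict_space1) (auto simp: space_restrict_space)
  then show ?thesis
    using assms by (rule measurable_compose)
qed

lemma nn_integral_coords_image:
  assumes S: "S \<in> sets lebesgue" and f: "f \<in> borel_measurable (lebesgue_on S)"
  shows "(\<integral>\<^sup>+y\<in>coords ` S. ennreal (f (uncoords y)) \<partial>lborel) = (\<integral>\<^sup>+x\<in>S. ennreal (f x) \<partial>lborel)"
proof -
  have "(\<lambda>x. ennreal (f x)) \<in> borel_measurable (lebesgue_on S)"
    using f by measurable
  then have "(\<lambda>x. ennreal (f x) * indicator S x) \<in> borel_measurable lebesgue"
    using S by (simp add: borel_measurable_restrict_space_iff_ennreal)
  from nn_integral_uncoords[OF this] show ?thesis
    by (simp add: indicator_def uncoords_vimage[symmetric])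
qed

text \<open>Conjugation with \<open>coords\<close> preserves the measure, and in these coordinates
  the derivative has matrix \<open>lin_matrix\<close>, so no further Jacobian factor
  appears.\<close>

lemma nn_integral_change_of_variables:
  fixes g :: "'a::euclidean_space \<Rightarrow> 'a" and f :: "'a \<Rightarrow> real"
  assumes S: "S \<in> sets lebesgue"
    and der: "\<And>x. x \<in> S \<Longrightarrow> (g has_derivative g' x) (at x within S)"
    and inj: "inj_on g S"
    and f: "f \<in> borel_measurable (lebesgue_on (g ` S))" and nonneg: "\<And>x. x \<in> g ` S \<Longrightarrow> 0 \<le> f x"
    and fg: "(\<lambda>x. \<bar>lin_det (g' x)\<bar> * f (g x)) \<in> borel_measurable (lebesgue_on S)"
  shows "(\<integral>\<^sup>+x\<in>g ` S. ennreal (f x) \<partial>lborel) = (\<integral>\<^sup>+x\<in>S. ennreal (\<bar>lin_det (g' x)\<bar> * f (g x)) \<partial>lborel)"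
proof -
  let ?G = "\<lambda>y. coords (g (uncoords y))"
  let ?G' = "\<lambda>y k. coords (g' (uncoords y) (uncoords k))"
  have gS: "g ` S \<in> sets lebesgue"
    by (rule differentiable_image_in_sets_lebesgue[OF S])
      (use der in \<open>auto simp: differentiable_on_def differentiable_def\<close>)
  have GS: "?G ` coords ` S = coords ` g ` S"
    by (simp add: image_image)
  have der': "(?G has_derivative ?G' y) (at y within coords ` S)" if "y \<in> coords ` S" for y
  proof -
    have U: "(uncoords has_derivative uncoords) (at y within coords ` S)"
      by (rule bounded_linear_imp_has_derivative[OF bounded_linear_uncoords])
    have "(g has_derivative g' (uncoords y)) (at (uncoords y) within uncoords ` coords ` S)"
      using der[of "uncoords y"] that by (auto simp: image_image)
    from has_derivative_in_compose[OF U this]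
    have "((\<lambda>y. g (uncoords y)) has_derivative (\<lambda>k. g' (uncoords y) (uncoords k))) (at y within coords ` S)" .
    from bounded_linear.has_derivative[OF bounded_linear_coords this] show ?thesis .
  qed
  have inj': "inj_on ?G (coords ` S)"
    using inj by (auto simp: inj_on_def) (metis uncoords_coords)
  have "(\<integral>\<^sup>+x\<in>g ` S. ennreal (f x) \<partial>lborel)
      = (\<integral>\<^sup>+y\<in>?G ` coords ` S. ennreal (f (uncoords y)) \<partial>lborel)"
    unfolding GS by (rule nn_integral_coords_image[OF gS f, symmetric])
  also have "\<dots> = (\<integral>\<^sup>+y\<in>coords ` S. ennreal (\<bar>det (matrix (?G' y))\<bar> * f (uncoords (?G y))) \<partial>lborel)"
  proof (rule nn_integral_change_of_variables_cart[OF lebesgue_coords_image[OF S] der' inj'])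
    show "(\<lambda>y. f (uncoords y)) \<in> borel_measurable (lebesgue_on (?G ` coords ` S))"
      unfolding GS by (rule borel_measurable_uncoords_lebesgue_on[OF f])
    show "(\<lambda>y. \<bar>det (matrix (?G' y))\<bar> * f (uncoords (?G y))) \<in> borel_measurable (lebesgue_on (coords ` S))"
      using borel_measurable_uncoords_lebesgue_on[OF fg] by (simp add: matrix_coords lin_det_def)
  qed (use nonneg in auto)
  also have "\<dots> = (\<integral>\<^sup>+x\<in>S. ennreal (\<bar>lin_det (g' x)\<bar> * f (g x)) \<partial>lborel)"
    using nn_integral_coords_image[OF S fg] by (simp add: matrix_coords lin_det_def)
  finally show ?thesis .
qed

section \<open>Liouville's theorem\<close>

theorem liouville_invariant_measure:
  fixes X :: "'a::euclidean_space \<Rightarrow> 'a" and \<mu> :: "'a \<Rightarrow> real"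
  assumes "open U" and X: "C1_on U X X'"
    and pos: "\<And>x. x \<in> U \<Longrightarrow> 0 < \<mu> x"
    and \<mu>: "\<And>x. x \<in> U \<Longrightarrow> (\<mu> has_derivative \<mu>' x) (at x)"
    and div: "\<And>x. x \<in> U \<Longrightarrow> \<mu>' x (X x) + \<mu> x * lin_trace (X' x) = 0"
  shows "invariant_measure U X \<mu>"
  unfolding invariant_measure_def
proof (intro allI impI, elim conjE)
  fix \<phi> :: "real \<Rightarrow> 'a \<Rightarrow> 'a" and t :: real and A
  assume A: "A \<in> sets lborel" "A \<subseteq> U"
    and \<phi>: "\<forall>x\<in>A. \<phi> 0 x = x \<and> (\<forall>s\<in>closed_segment 0 t. \<phi> s x \<in> U \<and>
      ((\<lambda>r. \<phi> r x) has_vector_derivative X (\<phi> s x)) (at s within closed_segment 0 t))"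
  have A_leb: "A \<in> sets lebesgue"
    using A(1) by auto
  \<comment> \<open>Rescaling time by \<open>t\<close> treats positive, zero and negative end times
    at once.\<close>
  define \<psi> where "\<psi> s x = \<phi> (s * t) x" for s x
  define Y where "Y = (\<lambda>x. t *\<^sub>R X x)"
  define Y' where "Y' = (\<lambda>x. t *\<^sub>R X' x)"
  have Y: "C1_on U Y Y'"
    unfolding Y_def Y'_def by (rule C1_on_scaleR[OF X])
  have seg: "closed_segment 0 t = (\<lambda>s. s * t) ` {0..1}"
    by (auto simp: closed_segment_def)
  have sol: "\<psi> 0 x = x \<and> solution_on U Y (\<lambda>s. \<psi> s x)" if x: "x \<in> A" for x
    unfolding solution_on_def
  proof (intro conjI ballI)
    show "\<psi> 0 x = x"
      using \<phi> x by (simp add: \<psi>_def)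
    fix s :: real assume s: "s \<in> {0..1}"
    then have st: "s * t \<in> closed_segment 0 t"
      unfolding seg by (rule imageI)
    then show "\<psi> s x \<in> U"
      using \<phi> x by (simp add: \<psi>_def)
    have "((\<lambda>r. \<phi> r x) has_vector_derivative X (\<phi> (s * t) x)) (at (s * t) within (\<lambda>s. s * t) ` {0..1})"
      using \<phi> x st seg by metis
    moreover have "((\<lambda>s. s * t) has_vector_derivative t) (at s within {0..1})"
      by (auto intro!: derivative_eq_intros)
    ultimately have "((\<lambda>r. \<phi> r x) \<circ> (\<lambda>s. s * t) has_vector_derivative t *\<^sub>R X (\<phi> (s * t) x)) (at s within {0..1})"
      by (intro vector_diff_chain_within)
    then show "((\<lambda>s. \<psi> s x) has_vector_derivative Y (\<psi> s x)) (at s within {0..1})"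
      by (simp add: \<psi>_def Y_def o_def)
  qed
  define g where "g = \<psi> 1"
  have inj: "inj_on g A"
  proof (rule inj_onI)
    fix x y assume "x \<in> A" "y \<in> A" "g x = g y"
    then show "x = y"
      using solutions_eq_backward[OF \<open>open U\<close> Y, of "\<lambda>s. \<psi> s x" "\<lambda>s. \<psi> s y"] sol
      by (simp add: g_def)
  qed
  have "\<exists>V. (g has_derivative blinfun_apply V) (at x within A) \<and> \<mu> (g x) * lin_det V = \<mu> x" if x: "x \<in> A" for x
  proof -
    let ?u = "\<lambda>s. \<psi> s x"
    note u = sol[OF x, THEN conjunct2]
    have uU: "?u ` {0..1} \<subseteq> U"
      using solution_onD(1)[OF u] by blast
    have "continuous_on {0..1} (\<lambda>s. Y' (?u s))"
      by (rule continuous_on_compose2[OF C1_onD(2)[OF Y] solution_on_continuous[OF u] uU])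
    from linear_ode_exists[OF this] obtain W where W: "W 0 = id_blinfun"
      "\<And>s. s \<in> {0..1} \<Longrightarrow> (W has_vector_derivative Y' (?u s) o\<^sub>L W s) (at s within {0..1})"
      by metis
    have "(g has_derivative blinfun_apply (W 1)) (at x within A)"
      unfolding g_def by (rule time_one_map_has_derivative[OF \<open>open U\<close> Y sol x W])
    moreover have "\<mu> (?u 1) * lin_det (W 1) = \<mu> (?u 0) * lin_det (W 0)"
    proof -
      have "((\<lambda>s. \<mu> (?u s) * lin_det (W s)) has_real_derivative 0) (at s within {0..1})" if s: "s \<in> {0..1}" for s
      proof -
        note us = solution_onD[OF u s]
        have "(\<mu> has_derivative \<mu>' (?u s)) (at (?u s) within ?u ` {0..1})"
          by (rule has_derivative_at_withinI[OF \<mu>[OF us(1)]])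
        note has_derivative_in_compose[OF us(2)[unfolded has_vector_derivative_def] this]
        moreover have "(\<lambda>h. \<mu>' (?u s) (h *\<^sub>R Y (?u s))) = (*) (t * \<mu>' (?u s) (X (?u s)))"
          using linear_scale[OF has_derivative_linear[OF \<mu>[OF us(1)]]]
          by (simp add: Y_def fun_eq_iff)
        ultimately have "((\<lambda>s. \<mu> (?u s)) has_real_derivative t * \<mu>' (?u s) (X (?u s))) (at s within {0..1})"
          by (simp add: has_field_derivative_def)
        moreover have "((\<lambda>s. lin_det (W s)) has_real_derivative
            (t * lin_trace (X' (?u s))) * lin_det (W s)) (at s within {0..1})"
          using has_real_derivative_lin_det[OF W(2)[OF s]]
          by (simp add: Y'_def lin_trace_def scaleR_blinfun.rep_eq sum_distrib_left)
        ultimately have "((\<lambda>s. \<mu> (?u s) * lin_det (W s)) has_real_derivative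
            t * (\<mu>' (?u s) (X (?u s)) + \<mu> (?u s) * lin_trace (X' (?u s))) * lin_det (W s)) (at s within {0..1})"
          by (auto intro!: derivative_eq_intros simp: algebra_simps)
        then show ?thesis
          by (simp add: div[OF us(1)])
      qed
      then obtain c where "\<And>s. s \<in> {0..1} \<Longrightarrow> \<mu> (?u s) * lin_det (W s) = c"
        using has_field_derivative_zero_constant[of "{0..1}" "\<lambda>s. \<mu> (?u s) * lin_det (W s)"] by auto
      then show ?thesis by simp
    qed
    then have "\<mu> (g x) * lin_det (W 1) = \<mu> x"
      using sol[OF x] by (simp add: W(1) g_def lin_det_id)
    ultimately show ?thesis by blast
  qed
  then obtain g' where g': "\<And>x. x \<in> A \<Longrightarrow> (g has_derivative blinfun_apply (g' x)) (at x within A)"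
    "\<And>x. x \<in> A \<Longrightarrow> \<mu> (g x) * lin_det (g' x) = \<mu> x"
    by metis
  have gU: "g ` A \<subseteq> U"
    using sol by (auto simp: g_def solution_on_def)
  have gA: "g ` A \<in> sets lebesgue"
    by (rule differentiable_image_in_sets_lebesgue[OF A_leb])
      (use g'(1) in \<open>auto simp: differentiable_on_def differentiable_def\<close>)
  have cont: "continuous_on U \<mu>"
    using \<mu> by (intro continuous_at_imp_continuous_on) (blast intro: has_derivative_continuous)
  \<comment> \<open>The density is positive at both ends of the trajectory, hence so is the
    determinant, and the modulus disappears.\<close>
  have det: "\<bar>lin_det (g' x)\<bar> * \<mu> (g x) = \<mu> x" if "x \<in> A" for x
  proof -
    have "0 < \<mu> (g x)" "0 < \<mu> x"
      using pos gU A(2) that by auto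
    then show ?thesis
      using g'(2)[OF that] by (metis abs_of_pos mult.commute zero_less_mult_pos)
  qed
  have "(\<integral>\<^sup>+x\<in>g ` A. ennreal (\<mu> x) \<partial>lborel) = (\<integral>\<^sup>+x\<in>A. ennreal (\<bar>lin_det (g' x)\<bar> * \<mu> (g x)) \<partial>lborel)"
  proof (rule nn_integral_change_of_variables[OF A_leb g'(1) inj])
    show "\<mu> \<in> borel_measurable (lebesgue_on (g ` A))"
      by (intro continuous_imp_measurable_on_sets_lebesgue gA continuous_on_subset[OF cont gU])
    \<comment> \<open>\<open>g'\<close> is chosen point by point and carries no measurability of its
      own; the product of Jacobian and density is measurable because it coincides with
      \<open>\<mu>\<close> on \<open>A\<close>.\<close>
    have "\<mu> \<in> borel_measurable (lebesgue_on A)"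
      by (intro continuous_imp_measurable_on_sets_lebesgue A_leb continuous_on_subset[OF cont A(2)])
    then show "(\<lambda>x. \<bar>lin_det (g' x)\<bar> * \<mu> (g x)) \<in> borel_measurable (lebesgue_on A)"
      using measurable_lebesgue_cong[of A "\<lambda>x. \<bar>lin_det (g' x)\<bar> * \<mu> (g x)" \<mu>] det by blast
  qed (use pos gU in \<open>auto intro: less_imp_le\<close>)
  also have "\<dots> = (\<integral>\<^sup>+x\<in>A. ennreal (\<mu> x) \<partial>lborel)"
    by (intro nn_integral_cong) (simp add: indicator_def det)
  finally show "(\<integral>\<^sup>+x\<in>\<phi> t ` A. ennreal (\<mu> x) \<partial>lborel) = (\<integral>\<^sup>+x\<in>A. ennreal (\<mu> x) \<partial>lborel)"
    by (simp add: g_def \<psi>_def)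
qed

text \<open>Cyclicity of the trace brings \<open>T\<close> next to \<open>T'\<close>, where they
  cancel.\<close>

lemma lin_trace_conj:
  fixes T T' f :: "'a::euclidean_space \<Rightarrow> 'a"
  assumes T: "linear T" and T': "linear T'" and f: "linear f" and inv: "\<And>x. T (T' x) = x"
  shows "lin_trace (\<lambda>x. T' (f (T x))) = lin_trace f"
proof -
  have "lin_trace (\<lambda>x. T' (f (T x))) = trace (lin_matrix T' ** lin_matrix (\<lambda>x. f (T x)))"
    by (simp add: trace_lin_matrix[symmetric] lin_matrix_compose[OF T', of "\<lambda>x. f (T x)"])
  also have "\<dots> = trace (lin_matrix f ** (lin_matrix T ** lin_matrix T'))"
    by (subst trace_mul_sym) (simp add: lin_matrix_compose[OF f, of T] matrix_mul_assoc)
  also have "lin_matrix T ** lin_matrix T' = lin_matrix (\<lambda>x. x)"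
    using lin_matrix_compose[OF T, of T'] by (simp add: inv)
  also have "lin_matrix f ** lin_matrix (\<lambda>x. x) = lin_matrix f"
    by (rule lin_matrix_compose[OF f, symmetric])
  finally show ?thesis
    by (simp add: trace_lin_matrix)
qed

text \<open>A linear change of variables has constant Jacobian, so the density is carried over by
  mere composition; in the divergence equation this shows as invariance of the trace under
  conjugation. It serves the passage from \<open>m\<close> to \<open>\<omega>\<close>.\<close>

corollary liouville_invariant_measure_conj:
  fixes X T T' :: "'a::euclidean_space \<Rightarrow> 'a" and \<mu> :: "'a \<Rightarrow> real"
  assumes "open U" and X: "C1_on U X X'"
    and pos: "\<And>x. x \<in> U \<Longrightarrow> 0 < \<mu> x"
    and \<mu>: "\<And>x. x \<in> U \<Longrightarrow> (\<mu> has_derivative \<mu>' x) (at x)"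
    and div: "\<And>x. x \<in> U \<Longrightarrow> \<mu>' x (X x) + \<mu> x * lin_trace (X' x) = 0"
    and T: "bounded_linear T" and T': "bounded_linear T'" and inv: "\<And>x. T (T' x) = x"
  shows "invariant_measure (T -` U) (\<lambda>x. T' (X (T x))) (\<lambda>x. \<mu> (T x))"
proof -
  define TL TL' where "TL = Blinfun T" and "TL' = Blinfun T'"
  have TL: "blinfun_apply TL = T" "blinfun_apply TL' = T'"
    using T T' by (simp_all add: TL_def TL'_def bounded_linear_Blinfun_apply)
  have der_T: "(T has_derivative T) (at x within S)" for x S
    by (rule bounded_linear_imp_has_derivative[OF T])
  have cont_T: "continuous_on S T" for S
    by (rule linear_continuous_on[OF T])
  show ?thesis
  proof (rule liouville_invariant_measure[where X' = "\<lambda>x. TL' o\<^sub>L X' (T x) o\<^sub>L TL"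
        and \<mu>' = "\<lambda>x h. \<mu>' (T x) (T h)"])
    show "open (T -` U)"
      using \<open>open U\<close> cont_T by (rule open_vimage)
    show "C1_on (T -` U) (\<lambda>x. T' (X (T x))) (\<lambda>x. TL' o\<^sub>L X' (T x) o\<^sub>L TL)"
      unfolding C1_on_def
    proof (intro conjI ballI)
      fix x assume "x \<in> T -` U"
      then have "(X has_derivative blinfun_apply (X' (T x))) (at (T x) within range T)"
        using C1_onD(1)[OF X] by (auto intro: has_derivative_at_withinI)
      from bounded_linear.has_derivative[OF T' has_derivative_in_compose[OF der_T this]]
      show "((\<lambda>x. T' (X (T x))) has_derivative blinfun_apply (TL' o\<^sub>L X' (T x) o\<^sub>L TL)) (at x)"
        by (simp add: TL blinfun_compose.rep_eq o_def)
    next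
      have "continuous_on (T -` U) (\<lambda>x. X' (T x))"
        by (rule continuous_on_compose2[OF C1_onD(2)[OF X] cont_T]) auto
      then show "continuous_on (T -` U) (\<lambda>x. TL' o\<^sub>L X' (T x) o\<^sub>L TL)"
        by (intro continuous_intros)
    qed
    fix x assume x: "x \<in> T -` U"
    show "0 < \<mu> (T x)"
      using pos x by simp
    have "(\<mu> has_derivative \<mu>' (T x)) (at (T x) within range T)"
      using \<mu> x by (auto intro: has_derivative_at_withinI)
    from has_derivative_in_compose[OF der_T this]
    show "((\<lambda>x. \<mu> (T x)) has_derivative (\<lambda>h. \<mu>' (T x) (T h))) (at x)" .
    have "lin_trace (blinfun_apply (TL' o\<^sub>L X' (T x) o\<^sub>L TL)) = lin_trace (X' (T x))"
      using lin_trace_conj[OF bounded_linear.linear[OF T] bounded_linear.linear[OF T']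
          bounded_linear.linear[OF blinfun.bounded_linear_right] inv, of "X' (T x)"]
      by (simp add: TL blinfun_compose.rep_eq o_def)
    then show "\<mu>' (T x) (T (T' (X (T x)))) + \<mu> (T x) * lin_trace (blinfun_apply (TL' o\<^sub>L X' (T x) o\<^sub>L TL)) = 0"
      using div x by (simp add: inv)
  qed
qed

section \<open>C1 maps and positive definite matrices\<close>

text \<open>Hides the derivative behind an existential, so that regularity of the field follows from
  closure rules without an explicit derivative of the multipliers.\<close>

definition C1 :: "'a::real_normed_vector set \<Rightarrow> ('a \<Rightarrow> 'b::real_normed_vector) \<Rightarrow> bool"
  where "C1 U f \<longleftrightarrow> (\<exists>f'. C1_on U f f')"

text \<open>The source space has finite dimension, so continuity of the derivative in each fixed
  direction \<open>h\<close> gives continuity in the operator norm.\<close>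

lemma C1_I:
  fixes f :: "'a::euclidean_space \<Rightarrow> 'b::real_normed_vector"
  assumes "\<And>x. x \<in> U \<Longrightarrow> (f has_derivative f' x) (at x)"
    and "\<And>h. continuous_on U (\<lambda>x. f' x h)"
  shows "C1 U f"
  unfolding C1_def C1_on_def
proof (intro exI conjI ballI)
  have eq: "blinfun_apply (Blinfun (f' x)) = f' x" if "x \<in> U" for x
    using assms(1)[OF that] by (intro bounded_linear_Blinfun_apply has_derivative_bounded_linear)
  show "(f has_derivative blinfun_apply (Blinfun (f' x))) (at x)" if "x \<in> U" for x
    using assms(1) that by (simp add: eq)
  show "continuous_on U (\<lambda>x. Blinfun (f' x))"
    using assms(2) by (intro continuous_on_blinfun_componentwise) (simp add: eq cong: continuous_on_cong)
qed

lemma C1_E: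
  assumes "C1 U f"
  obtains f' where "\<And>x. x \<in> U \<Longrightarrow> (f has_derivative f' x) (at x)"
    "\<And>h. continuous_on U (\<lambda>x. f' x h)" "continuous_on U f"
proof -
  obtain f' where f': "C1_on U f f'"
    using assms by (auto simp: C1_def)
  show ?thesis
  proof
    show d: "(f has_derivative blinfun_apply (f' x)) (at x)" if "x \<in> U" for x
      using C1_onD(1)[OF f' that] .
    show "continuous_on U (\<lambda>x. f' x h)" for h
      using C1_onD(2)[OF f'] by (intro continuous_intros)
    show "continuous_on U f"
      using d by (intro continuous_at_imp_continuous_on) (blast intro: has_derivative_continuous)
  qed
qed

lemma C1_cong:
  fixes f :: "'a::euclidean_space \<Rightarrow> 'b::real_normed_vector"
  assumes f: "C1 U f" and "open U" and eq: "\<And>x. x \<in> U \<Longrightarrow> f x = g x"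
  shows "C1 U g"
proof -
  obtain f' where f': "\<And>x. x \<in> U \<Longrightarrow> (f has_derivative f' x) (at x)" "\<And>h. continuous_on U (\<lambda>x. f' x h)"
    using C1_E[OF f] by metis
  show ?thesis
    by (rule C1_I[OF has_derivative_transform_within_open[OF f'(1) \<open>open U\<close>] f'(2)]) (use eq in auto)
qed

lemma C1_const: "C1 U (\<lambda>x. c)"
  unfolding C1_def C1_on_def by (intro exI[of _ "\<lambda>_. 0"]) (simp add: zero_blinfun.rep_eq)

lemma C1_bounded_linear:
  fixes f :: "'a::euclidean_space \<Rightarrow> 'b::real_normed_vector"
  assumes L: "bounded_linear L" and f: "C1 U f"
  shows "C1 U (\<lambda>x. L (f x))"
proof -
  obtain f' where f': "\<And>x. x \<in> U \<Longrightarrow> (f has_derivative f' x) (at x)" "\<And>h. continuous_on U (\<lambda>x. f' x h)"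
    using C1_E[OF f] by metis
  show ?thesis
    by (rule C1_I[OF bounded_linear.has_derivative[OF L f'(1)]])
      (auto intro: bounded_linear.continuous_on[OF L f'(2)])
qed

lemma C1_id: "C1 U (\<lambda>x::'a::euclidean_space. x)"
  by (rule C1_I[where f' = "\<lambda>_ h. h"]) (auto intro: continuous_intros)

lemma C1_add:
  fixes f g :: "'a::euclidean_space \<Rightarrow> 'b::real_normed_vector"
  assumes f: "C1 U f" and g: "C1 U g"
  shows "C1 U (\<lambda>x. f x + g x)"
proof -
  obtain f' where f': "\<And>x. x \<in> U \<Longrightarrow> (f has_derivative f' x) (at x)" "\<And>h. continuous_on U (\<lambda>x. f' x h)"
    using C1_E[OF f] by metis
  obtain g' where g': "\<And>x. x \<in> U \<Longrightarrow> (g has_derivative g' x) (at x)" "\<And>h. continuous_on U (\<lambda>x. g' x h)"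
    using C1_E[OF g] by metis
  show ?thesis
    by (rule C1_I[OF has_derivative_add[OF f'(1) g'(1)]]) (auto intro!: continuous_intros f' g')
qed

lemma C1_bilinear:
  fixes f :: "'a::euclidean_space \<Rightarrow> 'b::real_normed_vector" and g :: "'a \<Rightarrow> 'c::real_normed_vector"
  assumes p: "bounded_bilinear p" and f: "C1 U f" and g: "C1 U g"
  shows "C1 U (\<lambda>x. p (f x) (g x))"
proof -
  obtain f' where f': "\<And>x. x \<in> U \<Longrightarrow> (f has_derivative f' x) (at x)" "\<And>h. continuous_on U (\<lambda>x. f' x h)"
    "continuous_on U f"
    using C1_E[OF f] by metis
  obtain g' where g': "\<And>x. x \<in> U \<Longrightarrow> (g has_derivative g' x) (at x)" "\<And>h. continuous_on U (\<lambda>x. g' x h)"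
    "continuous_on U g"
    using C1_E[OF g] by metis
  show ?thesis
    by (rule C1_I[OF bounded_bilinear.FDERIV[OF p f'(1) g'(1)]])
      (auto intro!: continuous_on_add bounded_bilinear.continuous_on[OF p] f' g')
qed

lemmas C1_mult = C1_bilinear[OF bounded_bilinear_mult]
  and C1_scaleR = C1_bilinear[OF bounded_bilinear_scaleR]
  and C1_inner = C1_bilinear[OF bounded_bilinear_inner]

lemma C1_sum:
  fixes f :: "'i \<Rightarrow> 'a::euclidean_space \<Rightarrow> 'b::real_normed_vector"
  assumes "\<And>i. i \<in> S \<Longrightarrow> C1 U (f i)"
  shows "C1 U (\<lambda>x. \<Sum>i\<in>S. f i x)"
  using assms by (induction S rule: infinite_finite_induct) (auto intro: C1_const C1_add)

lemma C1_prod: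
  fixes f :: "'i \<Rightarrow> 'a::euclidean_space \<Rightarrow> real"
  assumes "\<And>i. i \<in> S \<Longrightarrow> C1 U (f i)"
  shows "C1 U (\<lambda>x. \<Prod>i\<in>S. f i x)"
  using assms by (induction S rule: infinite_finite_induct) (auto intro: C1_const C1_mult)

lemma C1_inverse:
  fixes f :: "'a::euclidean_space \<Rightarrow> real"
  assumes f: "C1 U f" and nz: "\<And>x. x \<in> U \<Longrightarrow> f x \<noteq> 0"
  shows "C1 U (\<lambda>x. inverse (f x))"
proof -
  obtain f' where f': "\<And>x. x \<in> U \<Longrightarrow> (f has_derivative f' x) (at x)" "\<And>h. continuous_on U (\<lambda>x. f' x h)"
    "continuous_on U f"
    using C1_E[OF f] by metis
  show ?thesis
    by (rule C1_I[OF Deriv.has_derivative_inverse[OF nz f'(1)]]) (use f' nz in \<open>auto intro!: continuous_intros\<close>)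
qed

lemma C1_det:
  fixes M :: "'a::euclidean_space \<Rightarrow> real^'n^'n"
  assumes "\<And>i j. C1 U (\<lambda>x. M x $ i $ j)"
  shows "C1 U (\<lambda>x. det (M x))"
  unfolding det_def by (intro C1_sum C1_mult C1_const C1_prod assms)

lemma C1_vec_lambda:
  fixes f :: "'a::euclidean_space \<Rightarrow> 'n::finite \<Rightarrow> 'b::euclidean_space"
  assumes "\<And>i. C1 U (\<lambda>x. f x i)"
  shows "C1 U (\<lambda>x. \<chi> i. f x i)"
proof -
  have "(\<chi> i. f x i) = (\<Sum>i\<in>UNIV. axis i (f x i))" for x
    by (simp add: vec_eq_iff axis_def)
  moreover have "bounded_linear (axis i :: 'b \<Rightarrow> 'b^'n)" for i
    by (intro linear_conv_bounded_linear[THEN iffD1] linearI) (auto simp: axis_def vec_eq_iff)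
  then have "C1 U (\<lambda>x. \<Sum>i\<in>UNIV. axis i (f x i))"
    by (intro C1_sum) (rule C1_bounded_linear[OF _ assms])
  ultimately show ?thesis
    by simp
qed

lemma C1_Pair:
  fixes f :: "'a::euclidean_space \<Rightarrow> 'b::real_normed_vector" and g :: "'a \<Rightarrow> 'c::real_normed_vector"
  assumes "C1 U f" "C1 U g"
  shows "C1 U (\<lambda>x. (f x, g x))"
proof -
  have "C1 U (\<lambda>x. (f x, 0) + (0, g x))"
    by (intro C1_add C1_bounded_linear[OF _ assms(1)] C1_bounded_linear[OF _ assms(2)] bounded_linear_intros)
  then show ?thesis by simp
qed

section \<open>Inverse and determinant of real matrices\<close>

lemma matrix_inv_right_left:
  fixes A :: "real^'n^'n"
  assumes "det A \<noteq> 0"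
  shows "A ** matrix_inv A = mat 1" "matrix_inv A ** A = mat 1"
proof -
  have "invertible A"
    using assms by (simp add: invertible_det_nz)
  then have "A ** matrix_inv A = mat 1 \<and> matrix_inv A ** A = mat 1"
    unfolding matrix_inv_def invertible_def by (rule someI_ex)
  then show "A ** matrix_inv A = mat 1" "matrix_inv A ** A = mat 1"
    by auto
qed

lemma matrix_inv_symmetric:
  fixes A :: "real^'n^'n"
  assumes "det A \<noteq> 0" "transpose A = A"
  shows "transpose (matrix_inv A) = matrix_inv A"
proof -
  let ?B = "matrix_inv A"
  have "transpose ?B ** A = mat 1"
    using matrix_transpose_mul[of A ?B] matrix_inv_right_left(1)[OF assms(1)] assms(2)
    by (simp add: transpose_mat)
  then have "transpose ?B = transpose ?B ** (A ** ?B)" "transpose ?B ** A ** ?B = ?B"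
    using matrix_inv_right_left(1)[OF assms(1)] by simp_all
  then show ?thesis
    by (simp add: matrix_mul_assoc)
qed

text \<open>Column \<open>j\<close> of the inverse solves the linear system with right side
  \<open>axis j 1\<close>. Exhibiting the entries as quotients of determinants is what shows that
  they depend on the matrix in a C1 way.\<close>

lemma matrix_inv_cramer:
  fixes A :: "real^'n^'n"
  assumes "det A \<noteq> 0"
  shows "matrix_inv A $ i $ j = det (\<chi> r s. if s = i then axis j 1 $ r else A $ r $ s) / det A"
proof -
  have "A *v column j (matrix_inv A) = axis j 1"
    using matrix_inv_right_left(1)[OF assms]
    by (simp add: vec_eq_iff matrix_vector_mult_def column_def matrix_matrix_mult_def mat_def axis_def)
  then have "column j (matrix_inv A) $ i = det (\<chi> r s. if s = i then axis j 1 $ r else A $ r $ s) / det A"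
    using cramer[OF assms, of "column j (matrix_inv A)" "axis j 1"] by simp
  then show ?thesis
    by (simp add: column_def)
qed

lemma C1_matrix_inv:
  fixes M :: "'a::euclidean_space \<Rightarrow> real^'n^'n"
  assumes "open U" and M: "\<And>i j. C1 U (\<lambda>x. M x $ i $ j)" and nz: "\<And>x. x \<in> U \<Longrightarrow> det (M x) \<noteq> 0"
  shows "C1 U (\<lambda>x. matrix_inv (M x) $ i $ j)"
proof (rule C1_cong[OF _ \<open>open U\<close>])
  have "C1 U (\<lambda>x. (\<chi> r s. if s = i then axis j 1 $ r else M x $ r $ s) $ k $ l)" for k l
    by (cases "l = i") (simp_all add: C1_const M)
  then show "C1 U (\<lambda>x. det (\<chi> r s. if s = i then axis j 1 $ r else M x $ r $ s) * inverse (det (M x)))"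
    by (intro C1_mult C1_inverse C1_det M nz)
  show "det (\<chi> r s. if s = i then axis j 1 $ r else M x $ r $ s) * inverse (det (M x)) = matrix_inv (M x) $ i $ j"
    if "x \<in> U" for x
    using matrix_inv_cramer[OF nz[OF that]] by (simp add: divide_inverse)
qed

lemma pos_def_det_nonzero:
  fixes A :: "real^'n^'n"
  assumes "\<And>c. c \<noteq> 0 \<Longrightarrow> 0 < c \<bullet> (A *v c)"
  shows "det A \<noteq> 0"
proof -
  have "\<forall>c. A *v c = 0 \<longrightarrow> c = 0"
    using assms by force
  then show ?thesis
    by (simp add: matrix_left_invertible_ker[symmetric] invertible_left_inverse[symmetric] invertible_det_nz)
qed

text \<open>The segment from the identity to \<^term>\<open>A\<close> consists of positive definite matrices, so the
  determinant cannot change its sign along it.\<close>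

lemma pos_def_det_pos:
  fixes A :: "real^'n^'n"
  assumes A: "\<And>c. c \<noteq> 0 \<Longrightarrow> 0 < c \<bullet> (A *v c)"
  shows "0 < det A"
proof (rule ccontr)
  assume "\<not> 0 < det A"
  define f where "f t = det ((1 - t) *\<^sub>R mat 1 + t *\<^sub>R A)" for t :: real
  have "continuous_on {0..1} f"
    unfolding f_def det_def by (intro continuous_intros)
  then obtain t where t: "0 \<le> t" "t \<le> 1" "f t = 0"
    using IVT2'[of f 1 0 0] \<open>\<not> 0 < det A\<close> by (auto simp: f_def)
  have "f t \<noteq> 0"
    unfolding f_def
  proof (rule pos_def_det_nonzero)
    fix c :: "real^'n" assume "c \<noteq> 0"
    have "c \<bullet> (((1 - t) *\<^sub>R mat 1 + t *\<^sub>R A) *v c) = (1 - t) * (c \<bullet> c) + t * (c \<bullet> (A *v c))"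
      by (simp add: matrix_vector_mult_add_rdistrib scaleR_matrix_vector_assoc[symmetric] inner_add_right)
    also have "\<dots> > 0"
      using t A[OF \<open>c \<noteq> 0\<close>] \<open>c \<noteq> 0\<close>
      by (cases "t = 1") (auto intro!: add_pos_nonneg mult_pos_pos mult_nonneg_nonneg)
    finally show "0 < c \<bullet> (((1 - t) *\<^sub>R mat 1 + t *\<^sub>R A) *v c)" .
  qed
  with t(3) show False by simp
qed

lemma sum_Basis_prod:
  "(\<Sum>b\<in>(Basis :: ('a::euclidean_space \<times> 'b::euclidean_space) set). f b)
    = (\<Sum>b\<in>Basis. f (b, 0)) + (\<Sum>c\<in>Basis. f (0, c))"
proof -
  have "inj_on (\<lambda>b::'a. (b, 0::'b)) Basis" "inj_on (\<lambda>c::'b. (0::'a, c)) Basis"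
    by (auto intro: inj_onI)
  moreover have "(\<lambda>b::'a. (b, 0::'b)) ` Basis \<inter> (\<lambda>c. (0, c)) ` Basis = {}"
    using nonzero_Basis by auto
  ultimately show ?thesis
    unfolding Basis_prod_def by (simp add: sum.union_disjoint sum.reindex)
qed

section \<open>The epsilon LR system\<close>

locale eLR_system =
  fixes br :: "'g::euclidean_space \<Rightarrow> 'g \<Rightarrow> 'g" and I :: "'g \<Rightarrow> 'g"
  assumes lie: "lie_algebra_invariant br" and spd: "sym_pos_def_op I"
begin

abbreviation J :: "'g \<Rightarrow> 'g" where "J \<equiv> inv I"

lemma bounded_bilinear_br: "bounded_bilinear br"
  using lie unfolding lie_algebra_invariant_def bilinear_conv_bounded_bilinear by (elim conjE)

interpretation br: bounded_bilinear br
  by (rule bounded_bilinear_br)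

lemma br_antisym: "br x y = - br y x"
  using lie unfolding lie_algebra_invariant_def by blast

lemma br_invariant: "br x y \<bullet> z = x \<bullet> br y z"
  using lie unfolding lie_algebra_invariant_def by blast

text \<open>Bracketing with a fixed \<open>y\<close> is skew, so its diagonal entries in
  \<open>Basis\<close> vanish. This removes the whole \<open>e\<close>-block and one term of the
  \<open>m\<close>-block from the divergence.\<close>

lemma br_orthogonal: "br x y \<bullet> x = 0"
proof -
  have "br x y \<bullet> x = x \<bullet> br y x"
    by (rule br_invariant)
  also have "\<dots> = - (br x y \<bullet> x)"
    by (subst br_antisym) (simp add: inner_commute)
  finally show ?thesis by simp
qed

lemma linear_I: "linear I" and I_sym: "I x \<bullet> y = x \<bullet> I y" and I_pos: "x \<noteq> 0 \<Longrightarrow> 0 < I x \<bullet> x"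
  using spd by (auto simp: sym_pos_def_op_def)

lemma bij_I: "bij I"
proof -
  have "inj I"
    unfolding linear_injective_0[OF linear_I] using I_pos by (metis inner_zero_left less_irrefl)
  then show ?thesis
    using linear_injective_imp_surjective[OF linear_I] by (simp add: bij_def)
qed

lemma I_J [simp]: "I (J x) = x"
  by (rule surj_f_inv_f[OF bij_is_surj[OF bij_I]])

lemma J_I [simp]: "J (I x) = x"
  by (rule inv_f_f[OF bij_is_inj[OF bij_I]])

lemma linear_J: "linear J"
proof (rule linearI)
  show "J (x + y) = J x + J y" for x y
    using J_I[of "J x + J y"] by (simp add: linear_add[OF linear_I] del: J_I)
  show "J (c *\<^sub>R x) = c *\<^sub>R J x" for c x
    using J_I[of "c *\<^sub>R J x"] by (simp add: linear_scale[OF linear_I] del: J_I)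
qed

lemma bounded_linear_I: "bounded_linear I" and bounded_linear_J: "bounded_linear J"
  by (rule linear_conv_bounded_linear[THEN iffD1, OF linear_I])
    (rule linear_conv_bounded_linear[THEN iffD1, OF linear_J])

interpretation J: bounded_linear J
  by (rule bounded_linear_J)

lemma J_sym: "J x \<bullet> y = x \<bullet> J y"
  using I_sym[of "J x" "J y"] by simp

lemma J_pos:
  assumes "x \<noteq> 0"
  shows "0 < J x \<bullet> x"
proof -
  have "J x \<noteq> 0"
  proof
    assume "J x = 0"
    then have "I (J x) = 0"
      by (simp only: linear_0[OF linear_I])
    then show False
      using assms by simp
  qed
  then show ?thesis
    using I_pos[of "J x"] J_sym[of x x] by simp
qed

lemma transpose_Amat: "transpose (Amat I e) = Amat I e"
  by (simp add: Amat_def transpose_def vec_eq_iff) (metis J_sym inner_commute)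

lemma Amat_mult: "(Amat I e *v c) $ i = e $ i \<bullet> J (\<Sum>j\<in>UNIV. c $ j *\<^sub>R e $ j)"
  by (simp add: Amat_def matrix_vector_mult_def J.sum J.scaleR inner_sum_right mult.commute)

lemma Amat_quadratic_form:
  "c \<bullet> (Amat I e *v c) = (\<Sum>j\<in>UNIV. c $ j *\<^sub>R e $ j) \<bullet> J (\<Sum>j\<in>UNIV. c $ j *\<^sub>R e $ j)"
  by (subst inner_vec_def) (simp add: Amat_mult inner_sum_left)

text \<open>\<open>Amat I e\<close> is the Gram matrix of the family for the scalar product given by
  \<open>J\<close>, hence positive definite. Positivity, beyond nonvanishing, is what makes its real
  powers positive and differentiable.\<close>

lemma det_Amat_pos:
  fixes e :: "'g^'k::finite"
  assumes "lin_indep_family e"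
  shows "0 < det (Amat I e)"
proof (rule pos_def_det_pos)
  fix c :: "real^'k" assume "c \<noteq> 0"
  then have "(\<Sum>j\<in>UNIV. c $ j *\<^sub>R e $ j) \<noteq> 0"
    using assms unfolding lin_indep_family_def vec_eq_iff zero_index by blast
  then show "0 < c \<bullet> (Amat I e *v c)"
    unfolding Amat_quadratic_form using J_pos by (simp add: inner_commute)
qed

text \<open>Replaces linear independence by the nonvanishing of a continuous function, so that
  \<open>phase_set\<close> is visibly open and the Gram matrix is invertible on it.\<close>

lemma lin_indep_family_iff: "lin_indep_family e \<longleftrightarrow> det (Amat I e) \<noteq> 0"
proof
  assume nz: "det (Amat I e) \<noteq> 0"
  show "lin_indep_family e"
    unfolding lin_indep_family_def
  proof (intro allI impI)
    fix c i assume "(\<Sum>i\<in>UNIV. c i *\<^sub>R e $ i) = 0"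
    then have "Amat I e *v (\<chi> i. c i) = 0"
      by (simp add: vec_eq_iff Amat_mult J.zero)
    then have "matrix_inv (Amat I e) *v (Amat I e *v (\<chi> i. c i)) = 0"
      by simp
    then have "(\<chi> i. c i) = 0"
      by (simp only: matrix_vector_mul_assoc matrix_inv_right_left(2)[OF nz] matrix_vector_mul_lid)
    then show "c i = 0"
      by (simp add: vec_eq_iff)
  qed
qed (use det_Amat_pos in force)

lemma det_Amat: "det (\<chi> i j. J (e $ i) \<bullet> e $ j) = det (Amat I e)"
  by (simp add: Amat_def J_sym)

section \<open>Regularity of the vector field\<close>

lemma C1_snd_component: "C1 U (\<lambda>x::'g \<times> ('g^'k::finite). snd x $ i)"
  by (intro C1_bounded_linear[OF bounded_linear_vec_nth] C1_bounded_linear[OF bounded_linear_snd] C1_id)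

lemma C1_fst: "C1 U (\<lambda>x::'g \<times> ('g^'k::finite). fst x)"
  by (intro C1_bounded_linear[OF bounded_linear_fst] C1_id)

lemma C1_Amat: "C1 U (\<lambda>x::'g \<times> ('g^'k::finite). Amat I (snd x) $ i $ j)"
  unfolding Amat_def by (simp add: C1_inner C1_bounded_linear[OF bounded_linear_J] C1_snd_component)

lemma phase_set_eq: "phase_set = {x::'g \<times> ('g^'k::finite). det (Amat I (snd x)) \<noteq> 0}"
  by (auto simp: phase_set_def lin_indep_family_iff)

lemma open_phase_set: "open (phase_set :: ('g \<times> ('g^'k::finite)) set)"
proof -
  have "continuous_on UNIV (\<lambda>x::'g \<times> ('g^'k). det (Amat I (snd x)))"
    using C1_E[OF C1_det[OF C1_Amat]] by metis
  then show ?thesis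
    unfolding phase_set_eq by (intro open_Collect_neq continuous_on_const)
qed

definition mult_field :: "'g \<Rightarrow> 'g^'k::finite \<Rightarrow> 'g"
  where "mult_field m e = (\<Sum>i\<in>UNIV. multipliers br I m e i *\<^sub>R e $ i)"

lemma multipliers_eq:
  "multipliers br I m e i = - (\<Sum>j\<in>UNIV. (e $ j \<bullet> J (br m (J m))) * matrix_inv (Amat I e) $ i $ j)"
  by (simp add: multipliers_def Let_def)

lemma eLR_field_m_eq:
  "eLR_field_m br I \<epsilon> x = (br (fst x) (J (fst x)) + mult_field (fst x) (snd x),
    \<chi> i. \<epsilon> *\<^sub>R br (snd x $ i) (J (fst x)))"
  by (simp add: eLR_field_m_def mult_field_def Let_def case_prod_unfold)

lemma C1_eLR_field_m: "C1 (phase_set :: ('g \<times> ('g^'k::finite)) set) (eLR_field_m br I \<epsilon>)"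
proof -
  have "C1 (phase_set :: ('g \<times> ('g^'k)) set) (\<lambda>x. matrix_inv (Amat I (snd x)) $ i $ j)" for i j
    by (rule C1_matrix_inv[OF open_phase_set C1_Amat]) (simp add: phase_set_eq)
  then have "C1 phase_set (\<lambda>x::'g \<times> ('g^'k). multipliers br I (fst x) (snd x) i)" for i
    unfolding multipliers_eq
    by (intro C1_bounded_linear[OF bounded_linear_minus[OF bounded_linear_ident]] C1_sum C1_mult C1_inner
        C1_snd_component C1_bounded_linear[OF bounded_linear_J] C1_bilinear[OF bounded_bilinear_br] C1_fst)
  then show ?thesis
    unfolding eLR_field_m_eq[abs_def] mult_field_def
    by (intro C1_Pair C1_add C1_vec_lambda C1_bounded_linear[OF bounded_linear_scaleR_right] C1_sum C1_scaleR
        C1_snd_component C1_bounded_linear[OF bounded_linear_J] C1_bilinear[OF bounded_bilinear_br] C1_fst)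
qed

section \<open>Divergence of the vector field\<close>

definition divergence_sum :: "'g \<Rightarrow> 'g^'k::finite \<Rightarrow> real"
  where "divergence_sum m e = (\<Sum>i\<in>UNIV. \<Sum>j\<in>UNIV. matrix_inv (Amat I e) $ i $ j * (J (e $ j) \<bullet> br (e $ i) (J m)))"

text \<open>By invariance the trace is the scalar product of \<open>m\<close> with the sum of
  \<open>br (J b) b\<close>. There the coefficients \<open>J b \<bullet> c\<close> are symmetric in
  \<open>b\<close> and \<open>c\<close>, while the bracket is antisymmetric.\<close>

lemma trace_br_J: "(\<Sum>b\<in>Basis. br m (J b) \<bullet> b) = 0"
proof -
  have "(\<Sum>b\<in>Basis. br (J b) b) = (\<Sum>b\<in>Basis. \<Sum>c\<in>Basis. (J b \<bullet> c) *\<^sub>R br c b)"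
    by (intro sum.cong refl)
      (metis (no_types, lifting) br.scaleR_left br.sum_left euclidean_representation sum.cong)
  also have "\<dots> = (\<Sum>c\<in>Basis. \<Sum>b\<in>Basis. (J b \<bullet> c) *\<^sub>R br c b)"
    by (rule sum.swap)
  also have "\<dots> = (\<Sum>c\<in>Basis. \<Sum>b\<in>Basis. - ((J c \<bullet> b) *\<^sub>R br b c))"
    using br_antisym by (intro sum.cong refl) (metis J_sym inner_commute scaleR_minus_right)
  also have "\<dots> = - (\<Sum>b\<in>Basis. \<Sum>c\<in>Basis. (J b \<bullet> c) *\<^sub>R br c b)"
    by (simp add: sum_negf)
  finally have "(\<Sum>b\<in>Basis. br (J b) b) = - (\<Sum>b\<in>Basis. br (J b) b)"
    by (metis (no_types, lifting) br.scaleR_left br.sum_left euclidean_representation sum.cong)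
  then have "(\<Sum>b\<in>Basis. br (J b) b) + (\<Sum>b\<in>Basis. br (J b) b) = 0"
    by (simp only: eq_neg_iff_add_eq_0)
  then have "(\<Sum>b\<in>Basis. br (J b) b) = 0"
    by (simp only: scaleR_2[symmetric] scaleR_eq_0_iff) simp
  then show ?thesis
    by (simp add: br_invariant inner_sum_right[symmetric])
qed

text \<open>Restricting \<open>D\<close> to the slices \<open>(u, e)\<close> and
  \<open>(m, u)\<close> and using uniqueness of derivatives reveals its two diagonal blocks, which
  are all that the trace sees.\<close>

lemma lin_trace_eLR_field_m:
  fixes e :: "'g^'k::finite"
  assumes e: "lin_indep_family e"
    and D: "(eLR_field_m br I \<epsilon> has_derivative D) (at (m, e))"
  shows "lin_trace D = - divergence_sum m e"
proof -
  let ?X = "eLR_field_m br I \<epsilon> :: 'g \<times> ('g^'k) \<Rightarrow> _"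
  let ?B = "matrix_inv (Amat I e)"
  have B_sym: "?B $ i $ j = ?B $ j $ i" for i j
    using matrix_inv_symmetric[OF _ transpose_Amat, of e] e
    by (simp add: lin_indep_family_iff transpose_def vec_eq_iff)
  \<comment> \<open>The derivative of the multipliers in \<open>m\<close> alone: the inverse Gram
    matrix depends on \<open>e\<close> and is a constant factor here.\<close>
  define dl where "dl i b = - (\<Sum>j\<in>UNIV. (e $ j \<bullet> J (br b (J m) + br m (J b))) * ?B $ i $ j)" for i b
  have br': "((\<lambda>u. br u (J u)) has_derivative (\<lambda>b. br b (J m) + br m (J b))) (at m)"
    using br.FDERIV[OF has_derivative_ident J.has_derivative[OF has_derivative_ident], of m UNIV]
    by (simp add: add.commute)
  have dl: "((\<lambda>u. multipliers br I u e i) has_derivative dl i) (at m)" for i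
    unfolding multipliers_eq dl_def
    by (intro has_derivative_minus has_derivative_sum has_derivative_mult_left
        has_derivative_inner_right J.has_derivative br')
  have fst_D: "fst (D (b, 0)) = br b (J m) + br m (J b) + (\<Sum>i\<in>UNIV. dl i b *\<^sub>R e $ i)" for b
  proof -
    have pair: "((\<lambda>u. (u, e)) has_derivative (\<lambda>b. (b, 0))) (at m)"
      by (auto intro!: derivative_eq_intros)
    have "(?X has_derivative D) (at (m, e) within range (\<lambda>u. (u, e)))"
      using D by (rule has_derivative_at_withinI)
    from has_derivative_fst[OF has_derivative_in_compose[OF pair this]]
    have 1: "((\<lambda>u. fst (?X (u, e))) has_derivative (\<lambda>b. fst (D (b, 0)))) (at m)" .
    have 2: "((\<lambda>u. fst (?X (u, e))) has_derivative
        (\<lambda>b. br b (J m) + br m (J b) + (\<Sum>i\<in>UNIV. dl i b *\<^sub>R e $ i))) (at m)"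
      unfolding eLR_field_m_eq mult_field_def fst_conv snd_conv
      by (intro has_derivative_add br' has_derivative_sum has_derivative_scaleR_left dl)
    show ?thesis
      using fun_cong[OF has_derivative_unique[OF 1 2]] .
  qed
  have snd_D: "snd (D (0, h)) $ i = \<epsilon> *\<^sub>R br (h $ i) (J m)" for h i
  proof -
    have pair: "((\<lambda>u. (m, u)) has_derivative (\<lambda>h. (0, h))) (at e)"
      by (auto intro!: derivative_eq_intros)
    have "(?X has_derivative D) (at (m, e) within range (\<lambda>u. (m, u)))"
      using D by (rule has_derivative_at_withinI)
    from bounded_linear.has_derivative[OF bounded_linear_vec_nth
        has_derivative_snd[OF has_derivative_in_compose[OF pair this]], of i]
    have 1: "((\<lambda>u. snd (?X (m, u)) $ i) has_derivative (\<lambda>h. snd (D (0, h)) $ i)) (at e)" .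
    have "bounded_linear (\<lambda>h::'g^'k. \<epsilon> *\<^sub>R br (h $ i) (J m))"
      by (intro bounded_linear_const_scaleR bounded_linear_compose[OF br.bounded_linear_left bounded_linear_vec_nth])
    then have 2: "((\<lambda>u. snd (?X (m, u)) $ i) has_derivative (\<lambda>h. \<epsilon> *\<^sub>R br (h $ i) (J m))) (at e)"
      unfolding eLR_field_m_eq by (simp add: bounded_linear_imp_has_derivative)
    show ?thesis
      using fun_cong[OF has_derivative_unique[OF 1 2]] .
  qed
  have e_part: "D (0, c) \<bullet> (0, c) = 0" if "c \<in> Basis" for c :: "'g^'k"
    using that by (auto simp: inner_prod_def Basis_vec_def inner_axis snd_D br_orthogonal)
  \<comment> \<open>The map sending \<open>b\<close> to \<open>dl i b *\<^sub>R e $ i\<close> has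
    rank at most one; its trace is the functional \<open>dl i\<close> evaluated at
    \<open>e $ i\<close>.\<close>
  have dl_trace: "(\<Sum>b\<in>Basis. dl i b * (e $ i \<bullet> b)) = dl i (e $ i)" for i
  proof -
    have "dl i (e $ i) = dl i (\<Sum>b\<in>Basis. (e $ i \<bullet> b) *\<^sub>R b)"
      by (simp add: euclidean_representation)
    also have "\<dots> = (\<Sum>b\<in>Basis. dl i b * (e $ i \<bullet> b))"
      using has_derivative_linear[OF dl] by (simp add: linear_sum linear_scale mult.commute)
    finally show ?thesis ..
  qed
  have "(\<Sum>b\<in>Basis. D (b, 0) \<bullet> (b, 0)) = (\<Sum>b\<in>Basis. br b (J m) \<bullet> b) + (\<Sum>b\<in>Basis. br m (J b) \<bullet> b)
      + (\<Sum>i\<in>UNIV. \<Sum>b\<in>Basis. dl i b * (e $ i \<bullet> b))"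
    by (subst sum.swap) (simp add: inner_prod_def fst_D inner_add_left inner_sum_left sum.distrib)
  also have "\<dots> = (\<Sum>i\<in>UNIV. dl i (e $ i))"
    by (simp add: br_orthogonal trace_br_J dl_trace)
  also have "\<dots> = - (\<Sum>i\<in>UNIV. \<Sum>j\<in>UNIV. ?B $ i $ j * (J (e $ j) \<bullet> br (e $ i) (J m)))
      - (\<Sum>i\<in>UNIV. \<Sum>j\<in>UNIV. ?B $ i $ j * (J (e $ j) \<bullet> br m (J (e $ i))))"
    by (simp add: dl_def J_sym[symmetric] inner_add_right distrib_left sum.distrib sum_negf sum_subtractf mult.commute)
  \<comment> \<open>Symmetric coefficients meet an expression that is antisymmetric in
    \<open>i\<close> and \<open>j\<close>, because \<open>br m\<close> is skew.\<close>
  also have "(\<Sum>i\<in>UNIV. \<Sum>j\<in>UNIV. ?B $ i $ j * (J (e $ j) \<bullet> br m (J (e $ i)))) = 0" (is "?S = 0")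
  proof -
    have anti: "J (e $ j) \<bullet> br m (J (e $ i)) = - (J (e $ i) \<bullet> br m (J (e $ j)))" for i j
      by (metis br_antisym br_invariant inner_commute inner_minus_left)
    have "?S = (\<Sum>i\<in>UNIV. \<Sum>j\<in>UNIV. - (?B $ j $ i * (J (e $ i) \<bullet> br m (J (e $ j)))))"
      using B_sym anti by (intro sum.cong refl) (metis mult_minus_right)
    also have "\<dots> = - ?S"
      by (subst sum.swap) (simp add: sum_negf)
    finally show ?thesis by simp
  qed
  finally show ?thesis
    by (simp add: lin_trace_def sum_Basis_prod e_part divergence_sum_def)
qed

section \<open>Growth of the Gram determinant along the field\<close>

definition Amat_deriv :: "'g^'k \<Rightarrow> 'g^'k \<Rightarrow> real^'k^'k::finite"
  where "Amat_deriv e h = (\<chi> i j. e $ i \<bullet> J (h $ j) + h $ i \<bullet> J (e $ j))"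

definition det_Amat_deriv :: "'g^'k \<Rightarrow> 'g^'k \<Rightarrow> real"
  where "det_Amat_deriv e h = (\<Sum>k\<in>UNIV. det (\<chi> i. if i = k then Amat_deriv e h $ k else Amat I e $ i))"

lemma has_derivative_det_Amat:
  "((\<lambda>x::'g \<times> ('g^'k::finite). det (Amat I (snd x))) has_derivative (\<lambda>h. det_Amat_deriv (snd x) (snd h))) (at x)"
  unfolding det_Amat_deriv_def
proof (rule has_derivative_det)
  fix i j
  have c: "((\<lambda>x::'g \<times> ('g^'k). snd x $ i) has_derivative (\<lambda>h. snd h $ i)) (at x)" for i
    by (intro bounded_linear_imp_has_derivative bounded_linear_compose[OF bounded_linear_vec_nth bounded_linear_snd])
  show "((\<lambda>x::'g \<times> ('g^'k). Amat I (snd x) $ i $ j) has_derivative (\<lambda>h. Amat_deriv (snd x) (snd h) $ i $ j)) (at x)"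
    unfolding Amat_def Amat_deriv_def
    using has_derivative_inner[OF c[of i] J.has_derivative[OF c[of j]]] by simp
qed

text \<open>Jacobi's formula wants the derivative as a matrix times the Gram matrix, hence the
  factorisation \<open>eq\<close> through the inverse. Both terms of \<open>Amat_deriv\<close>
  contribute the same sum because \<open>J\<close> and the inverse are symmetric; this is the factor
  2.\<close>

lemma det_Amat_deriv_along_field:
  fixes e :: "'g^'k::finite"
  assumes "lin_indep_family e"
  shows "det_Amat_deriv e (\<chi> i. \<epsilon> *\<^sub>R br (e $ i) (J m)) = 2 * \<epsilon> * divergence_sum m e * det (Amat I e)"
proof -
  let ?h = "(\<chi> i. \<epsilon> *\<^sub>R br (e $ i) (J m)) :: 'g^'k"
  let ?A = "Amat I e" and ?B = "matrix_inv (Amat I e)"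
  have nz: "det ?A \<noteq> 0"
    using assms by (simp add: lin_indep_family_iff)
  have B_sym: "?B $ i $ j = ?B $ j $ i" for i j
    using matrix_inv_symmetric[OF nz transpose_Amat] by (simp add: transpose_def vec_eq_iff)
  have eq: "(Amat_deriv e ?h ** ?B) ** ?A = Amat_deriv e ?h"
    using matrix_inv_right_left[OF nz] by (simp add: matrix_mul_assoc[symmetric])
  have "det_Amat_deriv e ?h = trace (Amat_deriv e ?h ** ?B) * det ?A"
    using jacobi_row_sum[of "Amat_deriv e ?h ** ?B" ?A] unfolding eq det_Amat_deriv_def .
  also have "trace (Amat_deriv e ?h ** ?B) = (\<Sum>i\<in>UNIV. \<Sum>j\<in>UNIV.
      \<epsilon> * (?B $ j $ i * (J (e $ i) \<bullet> br (e $ j) (J m))) + \<epsilon> * (?B $ j $ i * (J (e $ j) \<bullet> br (e $ i) (J m))))"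
  proof -
    have "e $ i \<bullet> J (\<epsilon> *\<^sub>R br (e $ j) (J m)) = \<epsilon> * (J (e $ i) \<bullet> br (e $ j) (J m))"
      "br (e $ i) (J m) \<bullet> J (e $ j) = J (e $ j) \<bullet> br (e $ i) (J m)" for i j
      by (simp_all add: J_sym J.scaleR inner_commute)
    then show ?thesis
      unfolding trace_def matrix_matrix_mult_def Amat_deriv_def vec_lambda_beta
      by (simp add: algebra_simps)
  qed
  also have "\<dots> = 2 * \<epsilon> * divergence_sum m e"
  proof -
    have "(\<Sum>i\<in>UNIV. \<Sum>j\<in>UNIV. ?B $ j $ i * (J (e $ i) \<bullet> br (e $ j) (J m))) = divergence_sum m e"
      unfolding divergence_sum_def by (rule sum.swap)
    moreover have "(\<Sum>i\<in>UNIV. \<Sum>j\<in>UNIV. ?B $ j $ i * (J (e $ j) \<bullet> br (e $ i) (J m))) = divergence_sum m e"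
      unfolding divergence_sum_def by (intro sum.cong refl arg_cong2[where f = "(*)"] B_sym)
    ultimately show ?thesis
      by (simp add: sum.distrib sum_distrib_left[symmetric])
  qed
  finally show ?thesis .
qed

lemma invariant_measures:
  assumes "\<epsilon> \<noteq> 0"
  defines "\<mu> \<equiv> \<lambda>x::'g \<times> ('g^'k::finite). det (Amat I (snd x)) powr (1 / (2 * \<epsilon>))"
  shows "invariant_measure phase_set (eLR_field_m br I \<epsilon>) \<mu>"
    and "invariant_measure phase_set (eLR_field_omega br I \<epsilon>) \<mu>"
proof -
  obtain X' where X': "C1_on (phase_set :: ('g \<times> ('g^'k)) set) (eLR_field_m br I \<epsilon>) X'"
    using C1_eLR_field_m unfolding C1_def by blast
  \<comment> \<open>The exponent with \<open>p * (2 * \<epsilon>) = 1\<close>: it makes the growth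
    rate of the density equal to \<open>divergence_sum\<close>, which the divergence contributes
    with the opposite sign.\<close>
  define p where "p = 1 / (2 * \<epsilon>)"
  define \<mu>' where "\<mu>' x h = p * det (Amat I (snd x)) powr (p - 1) * det_Amat_deriv (snd x) (snd h)" for x h :: "'g \<times> ('g^'k)"
  have pos: "0 < det (Amat I (snd x))" if "x \<in> phase_set" for x :: "'g \<times> ('g^'k)"
    using that det_Amat_pos by (auto simp: phase_set_def)
  have \<mu>_pos: "0 < \<mu> x" if "x \<in> phase_set" for x
    using pos[OF that] by (simp add: \<mu>_def)
  have \<mu>': "(\<mu> has_derivative \<mu>' x) (at x)" if "x \<in> phase_set" for x
  proof -
    have "((\<lambda>t. t powr p) has_derivative (*) (p * det (Amat I (snd x)) powr (p - 1))) (at (det (Amat I (snd x))))"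
      using has_real_derivative_powr[OF pos[OF that]] by (simp add: has_field_derivative_def)
    from has_derivative_compose[OF has_derivative_det_Amat this]
    show ?thesis
      unfolding \<mu>_def \<mu>'_def p_def .
  qed
  have div: "\<mu>' x (eLR_field_m br I \<epsilon> x) + \<mu> x * lin_trace (X' x) = 0" if x: "x \<in> phase_set" for x
  proof -
    let ?\<Delta> = "det (Amat I (snd x))" and ?s = "divergence_sum (fst x) (snd x)"
    have e: "lin_indep_family (snd x)"
      using x by (auto simp: phase_set_def)
    have "lin_trace (X' x) = - ?s"
      using lin_trace_eLR_field_m[OF e, of \<epsilon> "blinfun_apply (X' x)" "fst x"] C1_onD(1)[OF X' x] by simp
    moreover have "\<mu>' x (eLR_field_m br I \<epsilon> x) = p * ?\<Delta> powr (p - 1) * (2 * \<epsilon> * ?s * ?\<Delta>)"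
      unfolding \<mu>'_def eLR_field_m_eq snd_conv det_Amat_deriv_along_field[OF e] ..
    moreover have "p * ?\<Delta> powr (p - 1) * (2 * \<epsilon> * ?s * ?\<Delta>) = ?\<Delta> powr p * ?s"
      using pos[OF x] \<open>\<epsilon> \<noteq> 0\<close> by (simp add: p_def powr_diff)
    ultimately show ?thesis
      by (simp add: \<mu>_def p_def)
  qed
  show "invariant_measure phase_set (eLR_field_m br I \<epsilon>) \<mu>"
    by (rule liouville_invariant_measure[OF open_phase_set X' \<mu>_pos \<mu>' div])
  \<comment> \<open>\<open>T\<close> passes from \<open>(\<omega>, e)\<close> to
    \<open>(m, e)\<close>. Density and phase set depend on \<open>e\<close> only, so composing with
    \<open>T\<close> leaves both unchanged.\<close>
  define T T' where "T x = (I (fst x), snd x)" and "T' x = (J (fst x), snd x)" for x :: "'g \<times> ('g^'k)"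
  have bl: "bounded_linear T" "bounded_linear T'"
    unfolding T_def T'_def
    by (intro bounded_linear_Pair bounded_linear_snd bounded_linear_compose[OF bounded_linear_I bounded_linear_fst]
        bounded_linear_compose[OF bounded_linear_J bounded_linear_fst])+
  have inv: "T (T' x) = x" for x
    by (simp add: T_def T'_def)
  have "invariant_measure (T -` phase_set) (\<lambda>x. T' (eLR_field_m br I \<epsilon> (T x))) (\<lambda>x. \<mu> (T x))"
    by (rule liouville_invariant_measure_conj[OF open_phase_set X' \<mu>_pos \<mu>' div bl inv])
  moreover have "T -` phase_set = phase_set" "(\<lambda>x. \<mu> (T x)) = \<mu>"
    by (auto simp: T_def phase_set_def \<mu>_def)
  moreover have "(\<lambda>x. T' (eLR_field_m br I \<epsilon> (T x))) = eLR_field_omega br I \<epsilon>"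
    by (auto simp: T_def T'_def eLR_field_m_def eLR_field_omega_def Let_def)
  ultimately show "invariant_measure phase_set (eLR_field_omega br I \<epsilon>) \<mu>"
    by simp
qed

end

theorem theorem1:
  fixes br :: "'g::euclidean_space \<Rightarrow> 'g \<Rightarrow> 'g"
    and I :: "'g \<Rightarrow> 'g"
    and \<epsilon> :: real
  assumes "lie_algebra_invariant br"
    and "sym_pos_def_op I"
    and "\<epsilon> \<noteq> 0"
  shows "invariant_measure (phase_set :: ('g \<times> ('g ^ 'k::finite)) set) (eLR_field_m br I \<epsilon>)
           (\<lambda>(m, e). det (\<chi> i j. inner (inv I (e $ i)) (e $ j)) powr (1 / (2 * \<epsilon>)))
       \<and> invariant_measure (phase_set :: ('g \<times> ('g ^ 'k)) set) (eLR_field_omega br I \<epsilon>)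
           (\<lambda>(\<omega>, e). det (\<chi> i j. inner (inv I (e $ i)) (e $ j)) powr (1 / (2 * \<epsilon>)))"
proof -
  interpret eLR_system br I
    using assms by unfold_locales
  show ?thesis
    using invariant_measures[OF \<open>\<epsilon> \<noteq> 0\<close>] by (simp add: det_Amat case_prod_unfold)
qed

end
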